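(* Let $\{\mathbb{X},\mathscr{W},\mathbf{p}\}$ be an iterated function system belonging to the class $\Xi$, and let $\mu$ be its invariant measure. Suppose the strong open set condition holds and $\sum_{i\in M}p_i\log\gamma_i>-\infty$. Set \[ \underline{s}=\frac{\sum_{i\in M}p_i\log p_i}{\sum_{i\in M}p_i\log\gamma_i},\qquad \overline{s}=\frac{\sum_{i\in M}p_i\log p_i}{\sum_{i\in M}p_i\log\Gamma_i}. \] Then (i) $\underline{s}\le\dim_H\mu\le\dim_H^*\mu\le\overline{s}$, and (ii) $\underline{s}\le\dim_P\mu\le\dim_P^*\mu\le\overline{s}$.
   Context: Setting: $\mathbb{X}\subset\mathbb{R}^d$ and $M$ is a finite or countably infinite index set. The maps are $w_i:\mathbb{X}\to\mathbb{X}$ for $i\in M$, and $\mathbf{p}=\{p_i\}_{i\in M}$ is a probability vector with $p_i>0$ and $\sum_i p_i=1$. Bi-Lipschitz: each $w_i$ has constants $0<\gamma_i<\Gamma_i$ such that $\gamma_i|x-y|\le|w_i(x)-w_i(y)|\le\Gamma_i|x-y|$ for all $x,y\in\mathbb{X}$. Average contractivity: there exists $x\in\mathbb{X}$ such that $\sum_i p_i\Gamma_i<\infty$, $\sum_i p_i|w_i(x)-x|<\infty$, and $-\infty<\sum_i p_i\log\Gamma_i<0$. The class $\Xi$ consists of all such finite or infinite IFS whose maps are bi-Lipschitz and average contracting, and which satisfy $\sum_i p_i\log p_i>-\infty$. Symbolic coding: $M^\infty=M\times M\times\cdots$ carries the product measure $\mathbb{P}=\mathbf{p}\times\mathbf{p}\times\cdots$.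 Define $\pi(i_1,i_2,\dots)=\lim_{n\to\infty}w_{i_1}\circ\cdots\circ w_{i_n}(x_0)$ wherever the limit exists; under the hypotheses it exists $\mathbb{P}$-a.e. and does not depend on $x_0$. Invariant measure: $\mu=\mathbb{P}\circ\pi^{-1}$, which is the unique Borel probability measure with $\mu=\sum_i p_i\,\mu\circ w_i^{-1}$. Strong open set condition (SOSC): there is an open $\mathcal{O}\subset\mathbb{X}$ with $w_i(\mathcal{O})\subset\mathcal{O}$ for all $i$, $w_i(\mathcal{O})\cap w_j(\mathcal{O})=\emptyset$ for all $i\ne j$, and $\mu(\mathcal{O})>0$. Dimensions of a measure: $\dim_H\mu=\inf\{\dim_H E:\mu(E)>0\}$ and $\dim_H^*\mu=\inf\{\dim_H E:\mu(E)=1\}$. The quantities $\dim_P\mu$ and $\dim_P^*\mu$ are defined the same way using the packing dimension $\dim_P$. *)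

theory Defs
  imports "HOL-Analysis.Analysis" "HOL-Probability.Probability"
begin

definition hausdorff_content :: "real \<Rightarrow> real \<Rightarrow> 'a::euclidean_space set \<Rightarrow> ennreal" where
  "hausdorff_content s \<delta> E =
     (INF U \<in> {U :: nat \<Rightarrow> 'a set. E \<subseteq> (\<Union>j. U j) \<and> (\<forall>j. bounded (U j) \<and> diameter (U j) \<le> \<delta>)}.
        (\<Sum>j. ennreal (diameter (U j) powr s)))"

definition hausdorff_measure :: "real \<Rightarrow> 'a::euclidean_space set \<Rightarrow> ennreal" where
  "hausdorff_measure s E = (SUP \<delta> \<in> {0<..}. hausdorff_content s \<delta> E)"

text \<open>Hausdorff dimension: inf of the s > 0 with H^s(E) = 0 (for s > 0 the convention
  0 powr s = 0 is the correct one).\<close>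
definition hausdorff_dim :: "'a::euclidean_space set \<Rightarrow> real" where
  "hausdorff_dim E = Inf {s. 0 < s \<and> hausdorff_measure s E = 0}"

text \<open>delta-packings of E: finite families of pairwise disjoint closed balls centred in E with
  radii in (0, delta].  (The supremum over countable packings equals that over finite ones.)\<close>
definition packing_sum_delta :: "real \<Rightarrow> real \<Rightarrow> 'a::euclidean_space set \<Rightarrow> ennreal" where
  "packing_sum_delta s \<delta> E =
     (SUP B \<in> {B :: ('a \<times> real) set. finite B \<and> B \<subseteq> E \<times> {0<..\<delta>} \<and>
                 pairwise (\<lambda>a b. disjnt (cball (fst a) (snd a)) (cball (fst b) (snd b))) B}.
        (\<Sum>(x, r) \<in> B. ennreal ((2 * r) powr s)))"

definition packing_premeasure :: "real \<Rightarrow> 'a::euclidean_space set \<Rightarrow> ennreal" where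
  "packing_premeasure s E = (INF \<delta> \<in> {0<..}. packing_sum_delta s \<delta> E)"

definition packing_measure :: "real \<Rightarrow> 'a::euclidean_space set \<Rightarrow> ennreal" where
  "packing_measure s E =
     (INF F \<in> {F :: nat \<Rightarrow> 'a set. E \<subseteq> (\<Union>j. F j)}. (\<Sum>j. packing_premeasure s (F j)))"

definition packing_dim :: "'a::euclidean_space set \<Rightarrow> real" where
  "packing_dim E = Inf {s. 0 < s \<and> packing_measure s E = 0}"

definition hausdorff_dim_measure :: "'a::euclidean_space measure \<Rightarrow> real" where
  "hausdorff_dim_measure \<mu> = Inf (hausdorff_dim ` {E \<in> sets \<mu>. emeasure \<mu> E > 0})"

definition upper_hausdorff_dim_measure :: "'a::euclidean_space measure \<Rightarrow> real" where
  "upper_hausdorff_dim_measure \<mu> = Inf (hausdorff_dim ` {E \<in> sets \<mu>. emeasure \<mu> E = 1})"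

definition packing_dim_measure :: "'a::euclidean_space measure \<Rightarrow> real" where
  "packing_dim_measure \<mu> = Inf (packing_dim ` {E \<in> sets \<mu>. emeasure \<mu> E > 0})"

definition upper_packing_dim_measure :: "'a::euclidean_space measure \<Rightarrow> real" where
  "upper_packing_dim_measure \<mu> = Inf (packing_dim ` {E \<in> sets \<mu>. emeasure \<mu> E = 1})"

definition ifs_coding :: "('i \<Rightarrow> 'a::euclidean_space \<Rightarrow> 'a) \<Rightarrow> 'a \<Rightarrow> 'i stream \<Rightarrow> 'a" where
  "ifs_coding w x0 \<omega> = lim (\<lambda>n. foldr w (stake n \<omega>) x0)"

definition ifs_measure :: "'a::euclidean_space set \<Rightarrow> ('i \<Rightarrow> 'a \<Rightarrow> 'a) \<Rightarrow> 'i pmf \<Rightarrow> 'a measure" where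
  "ifs_measure X w p = distr (stream_space (measure_pmf p)) borel (ifs_coding w (SOME x. x \<in> X))"

end

theory Submission
  imports Defs
begin

text \<open>
  Everything is read off Birkhoff-type one-sided bounds for the shift on the code space: if
  \<open>E f < c\<close>, then almost surely \<open>f \<omega> + \<dots> + f (\<sigma>\<^sup>n\<^sup>-\<^sup>1 \<omega>) \<le> C(\<omega>) + n c\<close> for all \<open>n\<close>.

  Upper bound: the cylinder of \<open>\<omega>\<close> of length \<open>n\<close> has mass about \<open>exp (n E ln p)\<close>, and a fixed proportion of
  it is coded into a ball around \<open>\<pi> \<omega>\<close> of radius about \<open>exp (n E ln \<Gamma>)\<close>. So \<open>\<mu>(B(x, r)) \<ge> c r\<^sup>t\<close>
  for all \<open>r \<le> 1\<close>, on sets exhausting \<open>\<mu>\<close>; disjoint balls then have total mass at most 1.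

  Lower bound: \<open>w\<^sub>i(U)\<close> need not be open in \<open>X\<close>, so the cylinder sets are not separated metrically.
  They are when restricted to finitely many letters and a compact \<open>L \<subseteq> U\<close> of almost full measure: a set
  of small diameter then determines the first letter of every code \<open>\<omega>\<close> in it with \<open>\<pi>(\<sigma> \<omega>) \<in> L\<close>, and
  pulling back by the inverse branch enlarges the diameter by at most \<open>1 / \<gamma>\<close>. Weighting such good
  steps by \<open>\<alpha> / p\<^sub>i\<close> and the rare bad ones by \<open>1 - \<alpha>\<close>, the product of the weights over the steps for
  which the diameter stays small has integral at most 1 over the codes of any small set. As the
  product grows like \<open>exp (- n E ln p)\<close> up to an arbitrarily small error in the exponent, sets of
  diameter \<open>d\<close> have mass at most \<open>C d\<^sup>s\<close> on subsets of the code space of almost full measure.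
\<close>

subsection \<open>Hausdorff and packing dimension\<close>

text \<open>Each term \<open>(2 * r) powr t\<close> is at most a constant times
  \<open>\<delta> powr (t - u)\<close> times the mass of its ball. Disjoint balls share the finite
  total mass of \<open>\<nu>\<close>, so the packing sums vanish as \<open>\<delta>\<close> tends to
  0.\<close>

lemma packing_premeasure_eq_0:
  fixes F :: "'a::euclidean_space set" and \<nu> :: "'a measure"
  assumes fin: "finite_measure \<nu>" and sets: "sets \<nu> = sets borel"
    and c: "c > 0" and ut: "u < t"
    and mass: "\<And>x r. x \<in> F \<Longrightarrow> 0 < r \<Longrightarrow> r \<le> 1 \<Longrightarrow> c * r powr u \<le> measure \<nu> (cball x r)"
  shows "packing_premeasure t F = 0"
proof -
  interpret finite_measure \<nu> by fact
  have sp: "space \<nu> = UNIV" using sets by (metis sets_eq_imp_space_eq space_borel)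
  define K where "K = 2 powr t / c * measure \<nu> UNIV"
  have bound: "packing_sum_delta t \<delta> F \<le> ennreal (K * \<delta> powr (t - u))" if \<delta>: "0 < \<delta>" "\<delta> \<le> 1" for \<delta>
    unfolding packing_sum_delta_def
  proof (rule SUP_least, clarify)
    fix B :: "('a \<times> real) set"
    assume fB: "finite B" and B: "B \<subseteq> F \<times> {0<..\<delta>}"
      and pw: "pairwise (\<lambda>a b. disjnt (cball (fst a) (snd a)) (cball (fst b) (snd b))) B"
    have "(\<Sum>(x, r)\<in>B. (2 * r) powr t)
        \<le> (\<Sum>b\<in>B. 2 powr t / c * \<delta> powr (t - u) * measure \<nu> (cball (fst b) (snd b)))"
    proof (rule sum_mono, clarify)
      fix x r assume "(x, r) \<in> B"
      with B have x: "x \<in> F" and r: "0 < r" "r \<le> \<delta>" by auto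
      have "(2 * r) powr t = 2 powr t / c * r powr (t - u) * (c * r powr u)"
        using r c by (simp add: powr_mult powr_diff)
      also have "\<dots> \<le> 2 powr t / c * \<delta> powr (t - u) * measure \<nu> (cball x r)"
        using r c \<delta> ut by (intro mult_mono mass x powr_mono2) auto
      finally show "(2 * r) powr t \<le> 2 powr t / c * \<delta> powr (t - u) *
          measure \<nu> (cball (fst (x, r)) (snd (x, r)))" by simp
    qed
    also have "\<dots> = 2 powr t / c * \<delta> powr (t - u) * measure \<nu> (\<Union>b\<in>B. cball (fst b) (snd b))"
      using pw fB by (subst finite_measure_finite_Union)
        (auto simp: sets disjoint_family_on_def pairwise_def disjnt_def sum_distrib_left)
    also have "\<dots> \<le> 2 powr t / c * \<delta> powr (t - u) * measure \<nu> UNIV"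
      using c sets.top[of \<nu>] by (intro mult_left_mono finite_measure_mono) (auto simp: sp)
    also have "\<dots> = K * \<delta> powr (t - u)" by (simp add: K_def)
    finally have "(\<Sum>(x, r)\<in>B. (2 * r) powr t) \<le> K * \<delta> powr (t - u)" .
    then show "(\<Sum>(x, r)\<in>B. ennreal ((2 * r) powr t)) \<le> ennreal (K * \<delta> powr (t - u))"
      by (simp add: case_prod_unfold sum_ennreal ennreal_leI)
  qed
  have "((\<lambda>\<delta>. ennreal (K * \<delta> powr (t - u))) \<longlongrightarrow> ennreal (K * 0)) (at_right 0)"
    using ut by (intro tendsto_ennrealI tendsto_mult tendsto_const tendsto_zero_powrI)
       (auto simp: eventually_at_filter intro!: tendsto_ident_at)
  moreover have "\<forall>\<^sub>F \<delta> in at_right 0. packing_premeasure t F \<le> ennreal (K * \<delta> powr (t - u))"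
    unfolding eventually_at_right_field packing_premeasure_def
    by (rule exI[of _ 1]) (auto intro!: INF_lower2 bound)
  ultimately have "packing_premeasure t F \<le> ennreal (K * 0)"
    by (intro tendsto_lowerbound[of _ _ "at_right (0::real)"]) auto
  then show ?thesis by simp
qed

lemma packing_measure_eq_0:
  assumes "E \<subseteq> (\<Union>j. F j)" "\<And>j::nat. packing_premeasure t (F j) = 0"
  shows "packing_measure t E = 0"
proof -
  have "packing_measure t E \<le> (\<Sum>j. packing_premeasure t (F j))"
    unfolding packing_measure_def using assms(1) by (intro INF_lower) auto
  then show ?thesis by (simp add: assms(2))
qed

text \<open>Lebesgue measure gives balls of radius \<open>r\<close> mass of order
  \<open>r powr DIM('a)\<close>. This keeps the sets of exponents behind both dimensions nonempty,
  so that \<open>Inf\<close> is never taken over the empty set there.\<close>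

lemma packing_measure_above_DIM_eq_0:
  fixes E :: "'a::euclidean_space set" and t :: real
  assumes t: "t > DIM('a)"
  shows "packing_measure t E = 0"
proof (rule packing_measure_eq_0)
  show "E \<subseteq> (\<Union>j::nat. cball 0 (real j))"
    by (auto intro: real_arch_simple)
next
  fix j :: nat
  \<comment> \<open>The cutoff makes the measure finite; the margin 1 makes room for every ball of
    radius at most 1 centred in \<open>cball 0 (real j)\<close>.\<close>
  define A where "A = cball (0::'a) (real j + 1)"
  let ?\<nu> = "density lborel (indicator A)"
  have meas: "emeasure ?\<nu> S = emeasure lborel (A \<inter> S)" if "S \<in> sets borel" for S
  proof -
    have [measurable]: "A \<in> sets borel" "S \<in> sets borel" using that by (auto simp: A_def)
    show ?thesis
      by (subst emeasure_density)
        (auto simp: nn_integral_indicator[symmetric] indicator_inter_arith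
          simp del: nn_integral_indicator intro!: nn_integral_cong)
  qed
  show "packing_premeasure t (cball (0::'a) (real j)) = 0"
  proof (rule packing_premeasure_eq_0[where \<nu> = ?\<nu> and u = "DIM('a)" and c = "unit_ball_vol DIM('a)"])
    show "finite_measure ?\<nu>"
      using emeasure_lborel_cball_finite[of "0::'a" "real j + 1"] meas[of UNIV]
      by (intro finite_measureI) (simp add: A_def less_top)
  next
    fix x :: 'a and r :: real assume x: "x \<in> cball 0 (real j)" and r: "0 < r" "r \<le> 1"
    have "cball x r \<subseteq> A"
    proof
      fix y assume "y \<in> cball x r"
      then show "y \<in> A" unfolding A_def using x r dist_triangle[of 0 y x] by auto
    qed
    then have "A \<inter> cball x r = cball x r" by auto
    then have "emeasure ?\<nu> (cball x r) = emeasure lborel (cball x r)"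
      by (simp add: meas)
    then have "measure ?\<nu> (cball x r) = measure lborel (cball x r)"
      by (simp add: measure_def)
    also have "\<dots> = unit_ball_vol DIM('a) * r ^ DIM('a)"
      using r by (simp add: content_cball)
    finally show "unit_ball_vol DIM('a) * r powr DIM('a) \<le> measure ?\<nu> (cball x r)"
      using r by (simp add: powr_realpow)
  qed (use t in auto)
qed

text \<open>Take a maximal subset of \<open>F\<close> with distances above \<open>2 * r\<close>.
  Balls of radius \<open>r\<close> around it form a packing, and by maximality balls of radius
  \<open>2 * r\<close> cover \<open>F\<close>. Doubling the radius costs the factor
  \<open>2 powr s\<close>.\<close>

lemma packing_premeasure_cover:
  fixes F :: "'a::euclidean_space set"
  assumes s: "s > 0" and \<delta>: "\<delta> > 0" and c: "packing_premeasure s F < c"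
  shows "\<exists>U::nat \<Rightarrow> 'a set. F \<subseteq> (\<Union>j. U j) \<and> (\<forall>j. bounded (U j) \<and> diameter (U j) \<le> \<delta>) \<and>
           (\<Sum>j. ennreal (diameter (U j) powr s)) \<le> ennreal (2 powr s) * c"
proof -
  obtain \<delta>0 where \<delta>0: "\<delta>0 > 0" "packing_sum_delta s \<delta>0 F < c"
    using c unfolding packing_premeasure_def INF_less_iff by auto
  \<comment> \<open>Admissible in a packing at scale \<open>\<delta>0\<close>, and small enough that
    balls of radius \<open>2 * r\<close> have diameter at most \<open>\<delta>\<close>.\<close>
  define r where "r = min \<delta>0 (\<delta> / 4)"
  have r: "r > 0" "r \<le> \<delta>0" "4 * r \<le> \<delta>" using \<delta>0 \<delta> by (auto simp: r_def)
  define sep where "sep A \<longleftrightarrow> finite A \<and> A \<subseteq> F \<and> pairwise (\<lambda>a b. dist a b > 2 * r) A" for A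
  have sep_le: "of_nat (card A) * ennreal ((2 * r) powr s) \<le> packing_sum_delta s \<delta>0 F" if A: "sep A" for A
  proof -
    let ?B = "(\<lambda>x. (x, r)) ` A"
    have inj: "inj_on (\<lambda>x. (x, r)) A" by (auto simp: inj_on_def)
    have "disjnt (cball x r) (cball y r)" if "x \<in> A" "y \<in> A" "x \<noteq> y" for x y
    proof -
      have "dist x y > 2 * r" using A that by (auto simp: sep_def pairwise_def)
      then show ?thesis
        unfolding disjnt_iff mem_cball using dist_triangle2[of x y] by (smt (verit))
    qed
    then have "?B \<in> {B. finite B \<and> B \<subseteq> F \<times> {0<..\<delta>0} \<and>
                 pairwise (\<lambda>a b. disjnt (cball (fst a) (snd a)) (cball (fst b) (snd b))) B}"
      using A r by (auto simp: sep_def pairwise_def)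
    from SUP_upper[OF this, of "\<lambda>B. \<Sum>(x, r)\<in>B. ennreal ((2 * r) powr s)"]
    show ?thesis by (simp add: packing_sum_delta_def sum.reindex[OF inj])
  qed
  have fin: "packing_sum_delta s \<delta>0 F < \<top>" using \<delta>0(2) by (rule order_less_le_trans) simp
  define N where "N = nat \<lceil>enn2real (packing_sum_delta s \<delta>0 F) / (2 * r) powr s\<rceil>"
  have card_le: "card A \<le> N" if "sep A" for A
  proof -
    have "real (card A) * (2 * r) powr s = enn2real (of_nat (card A) * ennreal ((2 * r) powr s))"
      by (simp add: enn2real_mult)
    also have "\<dots> \<le> enn2real (packing_sum_delta s \<delta>0 F)"
      using sep_le[OF that] fin by (intro enn2real_mono) auto
    finally have "real (card A) \<le> enn2real (packing_sum_delta s \<delta>0 F) / (2 * r) powr s"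
      using r by (simp add: field_simps)
    then show ?thesis unfolding N_def by linarith
  qed
  have "sep {}" by (simp add: sep_def)
  \<comment> \<open>The finite packing sum bounds the size of separated sets, so one of largest
    cardinality exists.\<close>
  then obtain A where A: "sep A" and A_max: "\<And>A'. sep A' \<Longrightarrow> card A' \<le> card A"
    using ex_has_greatest_nat[of sep "{}" card "Suc N"] card_le by (metis le_imp_less_Suc)
  have cover: "\<exists>a\<in>A. dist a x \<le> 2 * r" if x: "x \<in> F" for x
  proof (rule ccontr)
    assume *: "\<not> ?thesis"
    then have "x \<notin> A" using r by force
    moreover have "sep (insert x A)" using A x * by (auto simp: sep_def pairwise_insert dist_commute not_le)
    ultimately show False using A_max[of "insert x A"] A by (auto simp: sep_def)
  qed
  obtain xs where xs: "set xs = A" "distinct xs" using A finite_distinct_list by (auto simp: sep_def)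
  \<comment> \<open>The empty tail adds nothing to the sum: its diameter is 0 and
    \<open>0 powr s = 0\<close>.\<close>
  define U where "U j = (if j < length xs then cball (xs ! j) (2 * r) else {})" for j
  have diam: "diameter (U j) \<le> 4 * r" for j
    using r diameter_cball[of "xs ! j" "2 * r"] by (auto simp: U_def)
  have "(\<Sum>j. ennreal (diameter (U j) powr s)) = (\<Sum>j<length xs. ennreal (diameter (U j) powr s))"
    by (rule suminf_finite) (auto simp: U_def)
  also have "\<dots> \<le> (\<Sum>j<length xs. ennreal ((4 * r) powr s))"
    by (intro sum_mono ennreal_leI powr_mono2 diam diameter_ge_0)
       (use s in \<open>auto simp: U_def\<close>)
  also have "\<dots> = of_nat (card A) * ennreal (2 powr s * (2 * r) powr s)"
    using distinct_card[OF xs(2)] xs(1) r by (simp add: powr_mult[symmetric])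
  also have "\<dots> = ennreal (2 powr s) * (of_nat (card A) * ennreal ((2 * r) powr s))"
    by (simp add: ennreal_mult mult_ac)
  also have "\<dots> \<le> ennreal (2 powr s) * c"
    using sep_le[OF A] \<delta>0(2) by (intro mult_left_mono) auto
  finally have le: "(\<Sum>j. ennreal (diameter (U j) powr s)) \<le> ennreal (2 powr s) * c" .
  have sub: "F \<subseteq> (\<Union>j. U j)"
  proof
    fix x assume "x \<in> F"
    then obtain a where a: "a \<in> A" "dist a x \<le> 2 * r" using cover by auto
    then obtain j where "j < length xs" "xs ! j = a" using xs by (metis in_set_conv_nth)
    then show "x \<in> (\<Union>j. U j)" using a by (auto simp: U_def intro!: exI[of _ j])
  qed
  have "\<forall>j. bounded (U j) \<and> diameter (U j) \<le> \<delta>"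
    using diam r by (auto simp: U_def intro: order_trans[of _ "4 * r"])
  with sub le show ?thesis by blast
qed

text \<open>\<open>E\<close> is split into pieces of small total premeasure, each piece is covered
  at scale \<open>\<delta>\<close>, and the countably many covers are merged into one
  sequence.\<close>

lemma hausdorff_measure_eq_0_if_packing_measure_eq_0:
  fixes E :: "'a::euclidean_space set"
  assumes s: "s > 0" and P: "packing_measure s E = 0"
  shows "hausdorff_measure s E = 0"
proof -
  have "hausdorff_content s \<delta> E \<le> 0" if \<delta>: "\<delta> > 0" for \<delta>
  proof (rule ennreal_le_epsilon)
    fix e :: real assume e: "e > 0"
    \<comment> \<open>One \<open>e'\<close> pays for the pieces and one for the slack below, so that
      the final bound \<open>2 powr s * (2 * e')\<close> equals \<open>e\<close>.\<close>
    define e' where "e' = e / (2 * 2 powr s)"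
    have e': "e' > 0" using e by (simp add: e'_def)
    obtain F where F: "E \<subseteq> (\<Union>j::nat. F j)" and sum: "(\<Sum>j. packing_premeasure s (F j)) < ennreal e'"
    proof -
      have "packing_measure s E < ennreal e'" using P e' by simp
      then show ?thesis unfolding packing_measure_def INF_less_iff using that by auto
    qed
    \<comment> \<open>The covering lemma needs a strict bound on each premeasure; the slacks sum to
      \<open>e'\<close>.\<close>
    define c where "c j = packing_premeasure s (F j) + ennreal (e' * (1/2) ^ Suc j)" for j
    have "packing_premeasure s (F j) < c j" for j
    proof -
      have "packing_premeasure s (F j) \<le> (\<Sum>j. packing_premeasure s (F j))"
        using sum_le_suminf[of "\<lambda>j. packing_premeasure s (F j)" "{j}"] by simp
      also have "\<dots> < \<top>" using sum by (rule order_less_le_trans) simp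
      finally show ?thesis using e' ennreal_add_left_cancel_less[of "packing_premeasure s (F j)" 0 "ennreal (e' * (1/2) ^ Suc j)"]
        unfolding c_def by (auto simp: less_top)
    qed
    then have "\<forall>j. \<exists>U::nat \<Rightarrow> 'a set. F j \<subseteq> (\<Union>i. U i) \<and> (\<forall>i. bounded (U i) \<and> diameter (U i) \<le> \<delta>) \<and>
           (\<Sum>i. ennreal (diameter (U i) powr s)) \<le> ennreal (2 powr s) * c j"
      using packing_premeasure_cover[OF s \<delta>] by blast
    then obtain U where U: "\<And>j::nat. F j \<subseteq> (\<Union>i::nat. U j i)"
       "\<And>j i. bounded (U j i) \<and> diameter (U j i) \<le> \<delta>"
       "\<And>j. (\<Sum>i. ennreal (diameter (U j i) powr s)) \<le> ennreal (2 powr s) * c j"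
      by metis
    define V where "V n = (case prod_decode n of (j, i) \<Rightarrow> U j i)" for n
    have "E \<subseteq> (\<Union>n. V n)"
    proof
      fix x assume "x \<in> E"
      then obtain j i where "x \<in> U j i" using F U(1) by blast
      then show "x \<in> (\<Union>n. V n)" by (intro UN_I[of "prod_encode (j, i)"]) (auto simp: V_def)
    qed
    then have "hausdorff_content s \<delta> E \<le> (\<Sum>n. ennreal (diameter (V n) powr s))"
      unfolding hausdorff_content_def by (intro INF_lower) (auto simp: V_def U(2) split: prod.splits)
    also have "\<dots> = (\<Sum>j. \<Sum>i. ennreal (diameter (U j i) powr s))"
    proof -
      have "(\<Sum>n. (\<lambda>(j, i). ennreal (diameter (U j i) powr s)) (prod_decode n))
          = (\<Sum>j. \<Sum>i. ennreal (diameter (U j i) powr s))"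
        by (rule suminf_ennreal_2dimen) simp
      then show ?thesis by (simp add: V_def case_prod_unfold)
    qed
    also have "\<dots> \<le> (\<Sum>j. ennreal (2 powr s) * c j)"
      by (intro suminf_le U(3)) auto
    also have "\<dots> = ennreal (2 powr s) * ((\<Sum>j. packing_premeasure s (F j)) + (\<Sum>j. ennreal (e' * (1/2) ^ Suc j)))"
      by (simp add: c_def suminf_add)
    also have "(\<Sum>j. ennreal (e' * (1/2) ^ Suc j)) = ennreal e'"
    proof (rule suminf_ennreal_eq)
      show "(\<lambda>j. e' * (1/2) ^ Suc j) sums e'" using sums_mult[OF power_half_series, of e'] by simp
    qed (use e' in auto)
    also have "ennreal (2 powr s) * ((\<Sum>j. packing_premeasure s (F j)) + ennreal e') \<le>
       ennreal (2 powr s) * (ennreal e' + ennreal e')"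
      using sum by (intro mult_left_mono add_right_mono) auto
    also have "\<dots> = ennreal (2 powr s * (2 * e'))"
      using e' by (simp add: ennreal_mult flip: ennreal_plus)
    also have "\<dots> = ennreal e" by (simp add: e'_def)
    finally show "hausdorff_content s \<delta> E \<le> 0 + ennreal e" by simp
  qed
  then have "hausdorff_measure s E \<le> 0"
    unfolding hausdorff_measure_def by (intro SUP_least) auto
  then show ?thesis by simp
qed

lemma packing_dim_le:
  assumes "t > 0" "packing_measure t E = 0"
  shows "packing_dim E \<le> t"
  unfolding packing_dim_def by (rule cInf_lower) (use assms in \<open>auto intro: bdd_belowI[of _ 0]\<close>)

lemma le_hausdorff_dim:
  fixes E :: "'a::euclidean_space set"
  assumes "\<And>t. t > 0 \<Longrightarrow> hausdorff_measure t E = 0 \<Longrightarrow> s \<le> t"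
  shows "s \<le> hausdorff_dim E"
proof -
  have "real DIM('a) + 1 \<in> {s. 0 < s \<and> hausdorff_measure s E = 0}"
    by (auto intro!: hausdorff_measure_eq_0_if_packing_measure_eq_0 packing_measure_above_DIM_eq_0)
  then show ?thesis
    unfolding hausdorff_dim_def using assms by (intro cInf_greatest) blast+
qed

lemma hausdorff_dim_nonneg: "0 \<le> hausdorff_dim (E :: 'a::euclidean_space set)"
  by (rule le_hausdorff_dim) simp

lemma hausdorff_dim_le_packing_dim: "hausdorff_dim E \<le> packing_dim (E :: 'a::euclidean_space set)"
  unfolding hausdorff_dim_def packing_dim_def
proof (rule cInf_superset_mono)
  have "real DIM('a) + 1 \<in> {s. 0 < s \<and> packing_measure s E = 0}"
    by (auto intro!: packing_measure_above_DIM_eq_0)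
  then show "{s. 0 < s \<and> packing_measure s E = 0} \<noteq> {}" by blast
qed (auto intro: bdd_belowI[of _ 0] hausdorff_measure_eq_0_if_packing_measure_eq_0)

text \<open>Since Hausdorff dimension never exceeds packing dimension, a Hausdorff bound from below
  and a packing bound from above settle all six inequalities.\<close>

lemma dim_measure_bounds:
  fixes \<mu> :: "'a::euclidean_space measure"
  assumes "prob_space \<mu>"
    and lower: "\<And>E. E \<in> sets \<mu> \<Longrightarrow> emeasure \<mu> E > 0 \<Longrightarrow> s_lo \<le> hausdorff_dim E"
    and upper: "\<And>t. t > s_up \<Longrightarrow> \<exists>E\<in>sets \<mu>. emeasure \<mu> E = 1 \<and> packing_dim E \<le> t"
  shows "s_lo \<le> hausdorff_dim_measure \<mu>" "hausdorff_dim_measure \<mu> \<le> upper_hausdorff_dim_measure \<mu>"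
    "upper_hausdorff_dim_measure \<mu> \<le> s_up" "s_lo \<le> packing_dim_measure \<mu>"
    "packing_dim_measure \<mu> \<le> upper_packing_dim_measure \<mu>" "upper_packing_dim_measure \<mu> \<le> s_up"
proof -
  interpret prob_space \<mu> by fact
  have full: "space \<mu> \<in> {E \<in> sets \<mu>. emeasure \<mu> E = 1}" by (simp add: emeasure_space_1)
  have pos: "{E \<in> sets \<mu>. emeasure \<mu> E = 1} \<subseteq> {E \<in> sets \<mu>. emeasure \<mu> E > 0}" by auto
  have bdd_H: "bdd_below (hausdorff_dim ` S)" for S :: "'a set set"
    by (auto intro!: bdd_belowI[of _ 0] hausdorff_dim_nonneg)
  have bdd_P: "bdd_below (packing_dim ` S)" for S :: "'a set set"
    by (auto intro!: bdd_belowI[of _ 0] order_trans[OF hausdorff_dim_nonneg hausdorff_dim_le_packing_dim])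
  show "s_lo \<le> hausdorff_dim_measure \<mu>"
    unfolding hausdorff_dim_measure_def using full pos by (intro cINF_greatest) (auto intro: lower)
  show "s_lo \<le> packing_dim_measure \<mu>"
    unfolding packing_dim_measure_def using full pos
    by (intro cINF_greatest) (auto intro: order_trans[OF lower hausdorff_dim_le_packing_dim])
  show "hausdorff_dim_measure \<mu> \<le> upper_hausdorff_dim_measure \<mu>"
    unfolding hausdorff_dim_measure_def upper_hausdorff_dim_measure_def
    using full pos by (intro cINF_superset_mono bdd_H) auto
  show "packing_dim_measure \<mu> \<le> upper_packing_dim_measure \<mu>"
    unfolding packing_dim_measure_def upper_packing_dim_measure_def
    using full pos by (intro cINF_superset_mono bdd_P) auto
  show "upper_packing_dim_measure \<mu> \<le> s_up"
  proof (rule dense_ge)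
    fix t assume "t > s_up"
    then obtain E where "E \<in> sets \<mu>" "emeasure \<mu> E = 1" "packing_dim E \<le> t" using upper by blast
    then show "upper_packing_dim_measure \<mu> \<le> t"
      unfolding upper_packing_dim_measure_def by (intro cINF_lower2[OF bdd_P, of E]) auto
  qed
  show "upper_hausdorff_dim_measure \<mu> \<le> s_up"
  proof (rule dense_ge)
    fix t assume "t > s_up"
    then obtain E where "E \<in> sets \<mu>" "emeasure \<mu> E = 1" "packing_dim E \<le> t" using upper by blast
    then show "upper_hausdorff_dim_measure \<mu> \<le> t"
      unfolding upper_hausdorff_dim_measure_def
      by (intro cINF_lower2[OF bdd_H, of E]) (auto intro: order_trans[OF hausdorff_dim_le_packing_dim])
  qed
qed

subsection \<open>Birkhoff sums over an ergodic transformation\<close>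

text \<open>
  The maximum of the Birkhoff sums of lengths \<open>0, \<dots>, n\<close>. In the recursive form, the bound
  \<open>m\<^sub>n \<le> f + m\<^sub>n \<circ> T\<close> on \<open>{m\<^sub>n > 0}\<close>, the heart of the maximal ergodic theorem, is immediate.
\<close>

primrec max_birkhoff_sum :: "('a \<Rightarrow> 'a) \<Rightarrow> ('a \<Rightarrow> real) \<Rightarrow> nat \<Rightarrow> 'a \<Rightarrow> real" where
  "max_birkhoff_sum T f 0 x = 0"
| "max_birkhoff_sum T f (Suc n) x = max 0 (f x + max_birkhoff_sum T f n (T x))"

lemma max_birkhoff_sum_nonneg: "0 \<le> max_birkhoff_sum T f n x"
  by (cases n) auto

lemma max_birkhoff_sum_mono: "max_birkhoff_sum T f n x \<le> max_birkhoff_sum T f (Suc n) x"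
proof (induction n arbitrary: x)
  case (Suc n)
  show ?case using Suc[of "T x"] by (simp only: max_birkhoff_sum.simps max.mono add_left_mono order_refl)
qed simp

lemma birkhoff_sum_le_max: "(\<Sum>k<n. f ((T ^^ k) x)) \<le> max_birkhoff_sum T f n x"
proof (induction n arbitrary: x)
  case (Suc n)
  have "(\<Sum>k<Suc n. f ((T ^^ k) x)) = f x + (\<Sum>k<n. f ((T ^^ k) (T x)))"
    by (simp add: sum.lessThan_Suc_shift funpow_swap1 del: sum.lessThan_Suc)
  also have "\<dots> \<le> max_birkhoff_sum T f (Suc n) x" using Suc[of "T x"] by simp
  finally show ?case .
qed simp

text \<open>Ergodicity is stated for strictly invariant sets; the event to which it is applied below
  is invariant exactly, not only up to null sets.\<close>

locale ergodic = prob_space M for M :: "'a measure" +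
  fixes T :: "'a \<Rightarrow> 'a"
  assumes T_measurable [measurable]: "T \<in> measurable M M"
    and T_preserves: "distr M M T = M"
    and T_ergodic: "\<And>A. A \<in> sets M \<Longrightarrow> T -` A \<inter> space M = A \<Longrightarrow> prob A = 0 \<or> prob A = 1"
begin

lemma T_funpow_measurable [measurable]: "T ^^ k \<in> measurable M M"
  by (induction k) (auto simp: measurable_comp T_measurable)

lemma AE_funpow:
  assumes "AE x in M. P x"
  shows "AE x in M. \<forall>k. P ((T ^^ k) x)"
  unfolding AE_all_countable
proof
  fix k
  have distr: "distr M M (T ^^ k) = M"
  proof (induction k)
    case 0
    show ?case by (simp add: id_def distr_id)
  next
    case (Suc k)
    have "distr M M (T ^^ Suc k) = distr (distr M M (T ^^ k)) M T"
      by (subst distr_distr) (auto simp: comp_def)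
    then show ?case by (simp only: Suc T_preserves)
  qed
  obtain N where N: "{x \<in> space M. \<not> P x} \<subseteq> N" "N \<in> null_sets M"
    using assms unfolding eventually_ae_filter by auto
  have "(T ^^ k) -` N \<inter> space M \<in> null_sets M"
    using N(2) null_sets_distr_iff[OF T_funpow_measurable, of N k] unfolding distr by blast
  moreover have "{x \<in> space M. \<not> P ((T ^^ k) x)} \<subseteq> (T ^^ k) -` N \<inter> space M"
    using N(1) measurable_space[OF T_funpow_measurable] by auto
  ultimately show "AE x in M. P ((T ^^ k) x)" by (rule AE_I')
qed

context
  fixes f :: "'a \<Rightarrow> real"
  assumes f: "integrable M f"
begin

lemma integrable_max_birkhoff_sum: "integrable M (max_birkhoff_sum T f n)"
proof (induction n)
  case (Suc n)
  have "integrable (distr M M T) (max_birkhoff_sum T f n)" using Suc by (simp add: T_preserves)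
  then have "integrable M (\<lambda>x. max_birkhoff_sum T f n (T x))"
    by (subst (asm) integrable_distr_eq) (use Suc in auto)
  then show ?case using f by simp
qed simp

lemma measurable_max_birkhoff_sum [measurable]: "max_birkhoff_sum T f n \<in> borel_measurable M"
  using integrable_max_birkhoff_sum by (rule borel_measurable_integrable)

lemma integrable_indicator_pos: "integrable M (\<lambda>x. indicator {x. 0 < max_birkhoff_sum T f n x} x * f x)"
proof (rule Bochner_Integration.integrable_bound[OF f])
  have [measurable]: "f \<in> borel_measurable M" using f by simp
  have "(\<lambda>x. if 0 < max_birkhoff_sum T f n x then f x else 0) \<in> borel_measurable M" by measurable
  then show "(\<lambda>x. indicator {x. 0 < max_birkhoff_sum T f n x} x * f x) \<in> borel_measurable M"
    by (rule measurable_cong[THEN iffD1, rotated]) (simp add: indicator_def)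
qed (simp add: indicator_def)

text \<open>By invariance \<open>max_birkhoff_sum T f n\<close> and its composition with
  \<open>T\<close> have the same integral. Their difference is at most \<open>f\<close> where the
  maximum is positive and at most 0 elsewhere.\<close>

lemma maximal_ergodic_inequality:
  "0 \<le> (\<integral>x. indicator {x. 0 < max_birkhoff_sum T f n x} x * f x \<partial>M)"
proof -
  let ?m = "max_birkhoff_sum T f n"
  have "integrable (distr M M T) ?m" by (simp add: T_preserves integrable_max_birkhoff_sum)
  then have int_T: "integrable M (\<lambda>x. ?m (T x))"
    by (subst (asm) integrable_distr_eq) auto
  have "(\<integral>x. ?m (T x) \<partial>M) = (\<integral>x. ?m x \<partial>distr M M T)"
    by (subst integral_distr) auto
  then have "0 = (\<integral>x. ?m x - ?m (T x) \<partial>M)"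
    using int_T by (simp add: T_preserves integrable_max_birkhoff_sum)
  also have "\<dots> \<le> (\<integral>x. indicator {x. 0 < ?m x} x * f x \<partial>M)"
  proof (rule integral_mono)
    show "integrable M (\<lambda>x. ?m x - ?m (T x))" using int_T by (simp add: integrable_max_birkhoff_sum)
    show "integrable M (\<lambda>x. indicator {x. 0 < ?m x} x * f x)"
      by (rule integrable_indicator_pos)
  next
    fix x
    show "?m x - ?m (T x) \<le> indicator {x. 0 < ?m x} x * f x"
    proof (cases "0 < ?m x")
      case True
      then obtain k where "n = Suc k" by (cases n) auto
      with True show ?thesis using max_birkhoff_sum_mono[of T f k "T x"] by (auto split: if_splits)
    next
      case False
      then show ?thesis using max_birkhoff_sum_nonneg[of T f n "T x"] by simp
    qed
  qed
  finally show ?thesis .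
qed

text \<open>Unboundedness of the maxima is an invariant event, so it has probability 0 or 1. If it
  were 1, the maxima would eventually be positive almost surely, and the maximal inequality would
  pass to the limit and make the mean of \<open>f\<close> nonnegative.\<close>

lemma birkhoff_sum_bounded_above:
  assumes neg: "(\<integral>x. f x \<partial>M) < 0"
  shows "AE x in M. \<exists>C. \<forall>n. (\<Sum>k<n. f ((T ^^ k) x)) \<le> C"
proof -
  let ?m = "max_birkhoff_sum T f"
  define A where "A = {x \<in> space M. \<forall>C::nat. \<exists>n. ?m n x > C}"
  have A [measurable]: "A \<in> sets M" unfolding A_def by measurable
  \<comment> \<open>Replacing \<open>x\<close> by \<open>T x\<close> shifts the index by one and
    changes the maxima by at most \<open>\<bar>f x\<bar>\<close>.\<close>
  have "T -` A \<inter> space M = A"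
  proof (intro equalityI subsetI)
    fix x assume "x \<in> T -` A \<inter> space M"
    then have x: "x \<in> space M" and *: "\<And>C::nat. \<exists>n. ?m n (T x) > C" by (auto simp: A_def)
    have "\<exists>n. ?m n x > C" for C :: nat
    proof -
      obtain n where "?m n (T x) > real (C + nat \<lceil>\<bar>f x\<bar>\<rceil>)" using * by blast
      then have "?m (Suc n) x > C" by (simp add: max_def) linarith
      then show ?thesis ..
    qed
    then show "x \<in> A" using x by (auto simp: A_def)
  next
    fix x assume "x \<in> A"
    then have x: "x \<in> space M" and *: "\<And>C::nat. \<exists>n. ?m n x > C" by (auto simp: A_def)
    have "\<exists>n. ?m n (T x) > C" for C :: nat
    proof -
      obtain n where n: "?m n x > real (C + nat \<lceil>\<bar>f x\<bar>\<rceil>)" using * by blast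
      have "?m n x \<noteq> 0" using n by linarith
      then obtain k where "n = Suc k" by (cases n) auto
      moreover have "C + \<bar>f x\<bar> < ?m n x" using n by linarith
      ultimately have "?m k (T x) > C" by (simp add: max_def split: if_splits)
      then show ?thesis ..
    qed
    then show "x \<in> T -` A \<inter> space M" using x measurable_space[OF T_measurable x] by (auto simp: A_def)
  qed
  then consider "prob A = 0" | "prob A = 1" using T_ergodic[OF A] by blast
  then show ?thesis
  proof cases
    case 1
    then have "AE x in M. x \<notin> A" by (intro AE_not_in) (simp add: null_sets_def emeasure_eq_measure)
    with AE_space show ?thesis
      by eventually_elim (auto simp: A_def not_less intro: order_trans[OF birkhoff_sum_le_max])
  next
    case 2
    have pos: "AE x in M. \<exists>n. ?m n x > 0"
      using AE_prob_1[OF 2] by (rule AE_mp) (force simp: A_def intro!: AE_I2 dest: spec[of _ 0])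
    \<comment> \<open>The maxima increase with \<open>n\<close>, so the indicator is eventually 1;
      \<open>\<bar>f x\<bar>\<close> dominates.\<close>
    have "(\<lambda>n. \<integral>x. indicator {x. 0 < ?m n x} x * f x \<partial>M) \<longlonglongrightarrow> (\<integral>x. f x \<partial>M)"
    proof (rule integral_dominated_convergence)
      show "AE x in M. (\<lambda>n. indicator {x. 0 < ?m n x} x * f x) \<longlonglongrightarrow> f x"
        using pos
      proof eventually_elim
        fix x assume "\<exists>n. ?m n x > 0"
        then obtain N where N: "?m N x > 0" ..
        have "?m n x > 0" if "n \<ge> N" for n
          using that N by (induction rule: dec_induct) (auto intro: less_le_trans[OF _ max_birkhoff_sum_mono] simp del: max_birkhoff_sum.simps)
        then have "\<forall>\<^sub>F n in sequentially. indicator {x. 0 < ?m n x} x * f x = f x"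
          unfolding eventually_sequentially by (intro exI[of _ N]) simp
        then show "(\<lambda>n. indicator {x. 0 < ?m n x} x * f x) \<longlonglongrightarrow> f x"
          by (rule tendsto_eventually)
      qed
      show "integrable M (\<lambda>x. \<bar>f x\<bar>)" using f by simp
    next
      show "(\<lambda>x. indicator {x. 0 < ?m n x} x * f x) \<in> borel_measurable M" for n
        using integrable_indicator_pos by (rule borel_measurable_integrable)
    qed (use f in \<open>auto simp: indicator_def\<close>)
    then have "0 \<le> (\<integral>x. f x \<partial>M)"
      by (rule LIMSEQ_le_const) (auto intro: maximal_ergodic_inequality)
    then show ?thesis using neg by simp
  qed
qed

end

text \<open>The function \<open>prob B / 2 - indicator B x\<close> has negative mean, so its sums
  are almost surely bounded above. Along an orbit that avoids \<open>B\<close> they would grow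
  linearly.\<close>

lemma AE_visits:
  assumes B: "B \<in> sets M" and pos: "prob B > 0"
  shows "AE x in M. \<exists>k. (T ^^ k) x \<in> B"
proof -
  let ?f = "\<lambda>x. prob B / 2 - indicator B x"
  have "integrable M ?f" using B by (intro Bochner_Integration.integrable_diff) (auto simp: emeasure_eq_measure)
  moreover have "(\<integral>x. ?f x \<partial>M) < 0"
    using B pos by (subst Bochner_Integration.integral_diff) (auto simp: emeasure_eq_measure prob_space)
  ultimately have "AE x in M. \<exists>C. \<forall>n. (\<Sum>k<n. ?f ((T ^^ k) x)) \<le> C"
    by (rule birkhoff_sum_bounded_above)
  then show ?thesis
  proof eventually_elim
    fix x assume "\<exists>C. \<forall>n. (\<Sum>k<n. ?f ((T ^^ k) x)) \<le> C"
    then obtain C where C: "\<And>n. (\<Sum>k<n. ?f ((T ^^ k) x)) \<le> C" by blast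
    obtain n :: nat where n: "C < real n * (prob B / 2)" using ex_less_of_nat_mult[of "prob B / 2" C] pos by auto
    show "\<exists>k. (T ^^ k) x \<in> B"
    proof (rule ccontr)
      assume "\<nexists>k. (T ^^ k) x \<in> B"
      then have "(\<Sum>k<n. ?f ((T ^^ k) x)) = real n * (prob B / 2)" by simp
      then show False using C[of n] n by simp
    qed
  qed
qed

end

section \<open>Ergodicity of the Bernoulli shift\<close>

lemma sdrop_eq_funpow: "sdrop n = stl ^^ n"
  by (induction n) (auto simp: fun_eq_iff funpow_swap1)

text \<open>Independence of the first letters and the tail, by integrating out one letter at a
  time.\<close>

lemma emeasure_stream_space_sstart_Int_sdrop:
  fixes p :: "'i::countable pmf"
  assumes A: "A \<in> sets (stream_space (measure_pmf p))"
  shows "emeasure (stream_space (measure_pmf p)) (sstart UNIV xs \<inter> sdrop (length xs) -` A)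
       = emeasure (stream_space (measure_pmf p)) (sstart UNIV xs) * emeasure (stream_space (measure_pmf p)) A"
proof (induction xs)
  let ?P = "stream_space (measure_pmf p)"
  interpret P: prob_space ?P by (rule prob_space.prob_space_stream_space[OF prob_space_measure_pmf])
  have sets_P: "sets ?P = sets (stream_space (count_space UNIV))"
    by (rule sets_stream_space_cong) simp
  have [simp]: "space ?P = UNIV" by (simp add: space_stream_space)
  {
    case Nil
    show ?case using P.emeasure_space_1 by (simp add: sstart.simps(1))
  next
    case (Cons x xs)
    have [measurable]: "sstart UNIV ys \<in> sets ?P" for ys unfolding sets_P by (rule sets_sstart)
    have [measurable]: "sdrop n -` A \<in> sets ?P" for n
      using measurable_sets[OF measurable_sdrop A] by simp
    let ?I = "\<integral>\<^sup>+y. indicator {x} y \<partial>measure_pmf p"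
    have "emeasure ?P (sstart UNIV (x # xs) \<inter> sdrop (length (x # xs)) -` A)
      = (\<integral>\<^sup>+y. indicator {x} y * emeasure ?P (sstart UNIV xs \<inter> sdrop (length xs) -` A) \<partial>measure_pmf p)"
      by (subst prob_space.emeasure_stream_space[OF prob_space_measure_pmf])
        (auto intro!: nn_integral_cong arg_cong[where f = "emeasure ?P"] split: split_indicator simp: emeasure_empty)
    moreover have "emeasure ?P (sstart UNIV (x # xs))
      = (\<integral>\<^sup>+y. indicator {x} y * emeasure ?P (sstart UNIV xs) \<partial>measure_pmf p)"
      by (subst prob_space.emeasure_stream_space[OF prob_space_measure_pmf])
        (auto intro!: nn_integral_cong arg_cong[where f = "emeasure ?P"] split: split_indicator)
    ultimately show ?case
      by (simp add: Cons nn_integral_multc mult.assoc del: sdrop.simps in_sstart list.size)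
  }
qed

text \<open>An invariant event \<open>A\<close> equals each of its preimages under
  \<open>sdrop n\<close>, hence is independent of every cylinder. Conditioning on \<open>A\<close>
  thus leaves all cylinder probabilities, and so the whole measure, unchanged; evaluated at
  \<open>A\<close> itself this gives probability 1.\<close>

lemma ergodic_stl:
  fixes p :: "'i::countable pmf"
  shows "ergodic (stream_space (measure_pmf p)) stl"
proof -
  let ?P = "stream_space (measure_pmf p)"
  interpret P: prob_space ?P by (rule prob_space.prob_space_stream_space[OF prob_space_measure_pmf])
  have sets_P: "sets ?P = sets (stream_space (count_space UNIV))"
    by (rule sets_stream_space_cong) simp
  have [simp]: "space ?P = UNIV" by (simp add: space_stream_space)
  show ?thesis
  proof
    show "stl \<in> measurable ?P ?P" by simp
    show "distr ?P ?P stl = ?P"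
    proof (rule measure_eqI)
      fix A assume "A \<in> sets (distr ?P ?P stl)"
      then have A [measurable]: "A \<in> sets ?P" by simp
      have "emeasure (distr ?P ?P stl) A = emeasure ?P (stl -` A)" by (simp add: emeasure_distr)
      also have "\<dots> = emeasure ?P A"
        using measurable_sets[OF measurable_stl A]
        by (subst prob_space.emeasure_stream_space[OF prob_space_measure_pmf]) (auto simp: measure_pmf.emeasure_space_1[simplified])
      finally show "emeasure (distr ?P ?P stl) A = emeasure ?P A" .
    qed simp
  next
    fix A assume A: "A \<in> sets ?P" and inv: "stl -` A \<inter> space ?P = A"
    show "P.prob A = 0 \<or> P.prob A = 1"
    proof (cases "P.prob A = 0")
      case False
      then have pos: "emeasure ?P A \<noteq> 0" by (simp add: P.emeasure_eq_measure)
      have inv_n: "sdrop n -` A = A" for n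
      proof (induction n)
        case (Suc n)
        have "sdrop (Suc n) -` A = stl -` (sdrop n -` A)" by auto
        then show ?case using Suc inv by (simp del: sdrop.simps)
      qed auto
      have emeasure_uniform: "emeasure (uniform_measure ?P A) B = emeasure ?P (A \<inter> B) / emeasure ?P A"
        if "B \<in> sets ?P" for B using A that by (rule emeasure_uniform_measure)
      have "uniform_measure ?P A = ?P"
      proof (rule stream_space_eq_sstart[of UNIV])
        show "prob_space (uniform_measure ?P A)"
          using pos A by (intro prob_space_uniform_measure) (auto simp: P.emeasure_eq_measure)
        fix xs :: "'i list"
        have [measurable]: "sstart UNIV xs \<in> sets ?P" unfolding sets_P by (rule sets_sstart)
        have "emeasure (uniform_measure ?P A) (sstart UNIV xs)
           = emeasure ?P (sstart UNIV xs \<inter> sdrop (length xs) -` A) / emeasure ?P A"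
          by (simp add: emeasure_uniform inv_n Int_commute)
        also have "\<dots> = emeasure ?P (sstart UNIV xs)"
        proof -
          have "P.prob (sstart UNIV xs \<inter> sdrop (length xs) -` A) = P.prob (sstart UNIV xs) * P.prob A"
            using emeasure_stream_space_sstart_Int_sdrop[OF A, of xs]
            by (simp add: P.emeasure_eq_measure flip: ennreal_mult)
          then show ?thesis
            using pos by (simp add: P.emeasure_eq_measure divide_ennreal zero_less_measure_iff)
        qed
        finally show "emeasure (uniform_measure ?P A) (sstart UNIV xs) = emeasure ?P (sstart UNIV xs)" .
      qed (auto simp: sets_P P.prob_space_axioms)
      then have "emeasure ?P A = emeasure ?P (A \<inter> A) / emeasure ?P A"
        using emeasure_uniform[OF A] by simp
      also have "\<dots> = 1" using pos by (simp add: ennreal_divide_self P.emeasure_eq_measure)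
      finally show ?thesis by (simp add: P.emeasure_eq_measure)
    qed simp
  qed
qed

subsection \<open>The coding map and the upper bound\<close>

text \<open>Geometric steps make the sequence Cauchy; the explicit rate is what the estimates on the
  coding need.\<close>

lemma geometric_steps_imp_convergent:
  fixes u :: "nat \<Rightarrow> 'a::complete_space"
  assumes q: "0 \<le> q" "q < 1" and step: "\<And>n. dist (u (Suc n)) (u n) \<le> C * q ^ n"
  obtains L where "u \<longlonglongrightarrow> L" "\<And>n. dist (u n) L \<le> C / (1 - q) * q ^ n"
proof -
  have C: "0 \<le> C" using order_trans[OF zero_le_dist step[of 0]] by simp
  have dist_le: "dist (u n) (u (n + m)) \<le> C / (1 - q) * q ^ n" for n m
  proof -
    \<comment> \<open>The induction needs the exact partial geometric sum, not just its
      limit.\<close>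
    have "dist (u n) (u (n + m)) \<le> C / (1 - q) * (q ^ n - q ^ (n + m))"
    proof (induction m)
      case (Suc m)
      have "dist (u n) (u (n + Suc m)) \<le> dist (u n) (u (n + m)) + dist (u (Suc (n + m))) (u (n + m))"
        using dist_triangle2 by simp
      also have "\<dots> \<le> C / (1 - q) * (q ^ n - q ^ (n + m)) + C * q ^ (n + m)"
        by (intro add_mono Suc step)
      also have "\<dots> = C / (1 - q) * (q ^ n - q ^ (n + Suc m))"
        using q by (simp add: field_simps)
      finally show ?case .
    qed simp
    also have "\<dots> \<le> C / (1 - q) * q ^ n" using q C by (intro mult_left_mono) auto
    finally show ?thesis .
  qed
  have lim0: "(\<lambda>n. C / (1 - q) * q ^ n) \<longlonglongrightarrow> 0"
    using q by (intro tendsto_mult_right_zero LIMSEQ_realpow_zero) auto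
  have "Cauchy u"
  proof (rule metric_CauchyI)
    fix e :: real assume "e > 0"
    then obtain N where N: "C / (1 - q) * q ^ N < e / 2"
      using order_tendstoD(2)[OF lim0, of "e / 2"] unfolding eventually_sequentially by auto
    have "dist (u N) (u k) < e / 2" if "k \<ge> N" for k
      using order.strict_trans1[OF dist_le[of N "k - N"] N] that by simp
    then have "dist (u m) (u n) < e" if "m \<ge> N" "n \<ge> N" for m n
      using dist_triangle_half_r[of "u N" "u m" e "u n"] that by blast
    then show "\<exists>M. \<forall>m\<ge>M. \<forall>n\<ge>M. dist (u m) (u n) < e" by blast
  qed
  then obtain L where L: "u \<longlonglongrightarrow> L" using Cauchy_convergent convergent_def by blast
  have "dist (u n) L \<le> C / (1 - q) * q ^ n" for n
  proof (rule LIMSEQ_le_const2)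
    show "(\<lambda>m. dist (u n) (u (m + n))) \<longlonglongrightarrow> dist (u n) L"
      using L by (intro tendsto_dist tendsto_const LIMSEQ_ignore_initial_segment)
    show "\<exists>N. \<forall>m\<ge>N. dist (u n) (u (m + n)) \<le> C / (1 - q) * q ^ n"
      using dist_le[of n] by (auto simp: add.commute)
  qed
  with L that show ?thesis by blast
qed

text \<open>For real families, summability is absolute summability, which is integrability for the
  counting measure with density \<open>pmf p\<close>. This turns the series of the theorem into
  means over a random letter.\<close>

lemma integrable_measure_pmf_if_summable:
  fixes g :: "'i \<Rightarrow> real"
  assumes "(\<lambda>i. pmf p i * g i) summable_on UNIV"
  shows "integrable (measure_pmf p) g" "(\<integral>i. g i \<partial>measure_pmf p) = (\<Sum>\<^sub>\<infinity>i. pmf p i * g i)"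
proof -
  have abs: "Infinite_Set_Sum.abs_summable_on (\<lambda>i. pmf p i * g i) UNIV"
    by (rule abs_summable_equivalent[THEN iffD1, OF summable_on_iff_abs_summable_on_real[THEN iffD1, OF assms]])
  then show "integrable (measure_pmf p) g"
    by (simp add: measure_pmf_eq_density integrable_density abs_summable_on_def)
  have "(\<integral>i. g i \<partial>measure_pmf p) = infsetsum (\<lambda>i. pmf p i * g i) UNIV"
    by (simp add: measure_pmf_eq_density integral_density infsetsum_def)
  then show "(\<integral>i. g i \<partial>measure_pmf p) = (\<Sum>\<^sub>\<infinity>i. pmf p i * g i)"
    by (simp add: infsetsum_infsum[OF abs])
qed

section \<open>Sums along independent letters\<close>

locale iid_letters =
  fixes p :: "'i::countable pmf"
begin

abbreviation "P \<equiv> stream_space (measure_pmf p)"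

sublocale P: ergodic P stl by (rule ergodic_stl)

lemma space_P [simp]: "space P = UNIV"
  by (simp add: space_stream_space)

lemma emeasure_P_UNIV [simp]: "emeasure P UNIV = 1"
  using P.emeasure_space_1 by simp

lemma sets_P: "sets P = sets (stream_space (count_space UNIV))"
  by (rule sets_stream_space_cong) simp

lemma measurable_letter [measurable]: "(\<lambda>\<omega>. g (\<omega> !! n)) \<in> borel_measurable P"
  for g :: "'i \<Rightarrow> real"
  by (rule measurable_compose[OF measurable_snth]) simp

lemma AE_sdrop: "AE \<omega> in P. Q \<omega> \<Longrightarrow> AE \<omega> in P. \<forall>k. Q (sdrop k \<omega>)"
  unfolding sdrop_eq_funpow by (rule P.AE_funpow)

lemma distr_shd: "distr P (measure_pmf p) shd = measure_pmf p"
proof (rule measure_eqI)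
  fix A assume "A \<in> sets (distr P (measure_pmf p) shd)"
  have "emeasure (distr P (measure_pmf p) shd) A = emeasure P (shd -` A)"
    by (simp add: emeasure_distr)
  also have "\<dots> = (\<integral>\<^sup>+i. indicator A i \<partial>measure_pmf p)"
  proof -
    have "emeasure P (shd -` A) = (\<integral>\<^sup>+i. emeasure P (if i \<in> A then UNIV else {}) \<partial>measure_pmf p)"
      using measurable_sets[OF measurable_shd, of A "measure_pmf p"]
      by (subst prob_space.emeasure_stream_space[OF prob_space_measure_pmf]) auto
    also have "\<dots> = (\<integral>\<^sup>+i. indicator A i \<partial>measure_pmf p)"
      by (intro nn_integral_cong) (simp split: split_indicator)
    finally show ?thesis .
  qed
  finally show "emeasure (distr P (measure_pmf p) shd) A = emeasure (measure_pmf p) A" by simp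
qed simp

lemma
  fixes g :: "'i \<Rightarrow> real"
  assumes g: "integrable (measure_pmf p) g"
  shows integrable_shd: "integrable P (\<lambda>\<omega>. g (shd \<omega>))"
    and integral_shd: "(\<integral>\<omega>. g (shd \<omega>) \<partial>P) = (\<integral>i. g i \<partial>measure_pmf p)"
proof -
  have "integrable (distr P (measure_pmf p) shd) g" using g by (simp add: distr_shd)
  then show "integrable P (\<lambda>\<omega>. g (shd \<omega>))" by (subst (asm) integrable_distr_eq) auto
  have "(\<integral>i. g i \<partial>distr P (measure_pmf p) shd) = (\<integral>\<omega>. g (shd \<omega>) \<partial>P)"
    by (subst integral_distr) auto
  then show "(\<integral>\<omega>. g (shd \<omega>) \<partial>P) = (\<integral>i. g i \<partial>measure_pmf p)" by (simp add: distr_shd)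
qed

text \<open>Subtracting \<open>c\<close> makes the mean negative, so the sums of the difference are
  almost surely bounded above.\<close>

lemma birkhoff_sum_linear_bound:
  assumes f: "integrable P f" and c: "(\<integral>\<omega>. f \<omega> \<partial>P) < c"
  shows "AE \<omega> in P. \<exists>C. \<forall>n. (\<Sum>k<n. f (sdrop k \<omega>)) \<le> C + real n * c"
proof -
  have "integrable P (\<lambda>\<omega>. f \<omega> - c)" using f by simp
  moreover have "(\<integral>\<omega>. f \<omega> - c \<partial>P) < 0" using f c by (simp add: P.prob_space[simplified])
  ultimately have "AE \<omega> in P. \<exists>C. \<forall>n. (\<Sum>k<n. f ((stl ^^ k) \<omega>) - c) \<le> C"
    by (rule P.birkhoff_sum_bounded_above)
  then show ?thesis by eventually_elim (auto simp: sum_subtractf sdrop_eq_funpow algebra_simps)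
qed

lemma letter_sum_linear_bound:
  assumes g: "integrable (measure_pmf p) g" and c: "(\<integral>i. g i \<partial>measure_pmf p) < c"
  shows "AE \<omega> in P. \<exists>C. \<forall>n. (\<Sum>k<n. g (\<omega> !! k)) \<le> C + real n * c"
  using birkhoff_sum_linear_bound[OF integrable_shd[OF g], unfolded integral_shd[OF g], OF c]
  by (simp only: sdrop_simps)

lemma emeasure_sstart: "emeasure P (sstart UNIV (stake n \<omega>)) = ennreal (\<Prod>k<n. pmf p (\<omega> !! k))"
proof (induction n arbitrary: \<omega>)
  case 0
  show ?case using P.emeasure_space_1 by (simp add: sstart.simps(1))
next
  case (Suc n)
  have [measurable]: "sstart UNIV ys \<in> sets P" for ys unfolding sets_P by (rule sets_sstart)
  have "emeasure P (sstart UNIV (shd \<omega> # stake n (stl \<omega>)))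
      = (\<integral>\<^sup>+y. indicator {shd \<omega>} y * emeasure P (sstart UNIV (stake n (stl \<omega>))) \<partial>measure_pmf p)"
    by (subst prob_space.emeasure_stream_space[OF prob_space_measure_pmf])
      (auto intro!: nn_integral_cong arg_cong[where f = "emeasure P"] split: split_indicator)
  also have "\<dots> = ennreal (pmf p (shd \<omega>)) * ennreal (\<Prod>k<n. pmf p (stl \<omega> !! k))"
    by (simp add: nn_integral_multc Suc emeasure_pmf_single)
  finally show ?case
    by (simp add: prod.lessThan_Suc_shift ennreal_mult' del: prod.lessThan_Suc)
qed

end

section \<open>Average contraction and almost sure convergence of the coding\<close>

locale average_contracting_ifs = iid_letters p
  for p :: "'i::countable pmf" +
  fixes X :: "'a::euclidean_space set" and w :: "'i \<Rightarrow> 'a \<Rightarrow> 'a" and \<Gamma> :: "'i \<Rightarrow> real" and a :: 'a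
  assumes maps: "\<And>i x. x \<in> X \<Longrightarrow> w i x \<in> X"
    and \<Gamma>_pos: "\<And>i. \<Gamma> i > 0"
    and lipschitz: "\<And>i x y. x \<in> X \<Longrightarrow> y \<in> X \<Longrightarrow> dist (w i x) (w i y) \<le> \<Gamma> i * dist x y"
    and a: "a \<in> X"
    and drift: "integrable (measure_pmf p) (\<lambda>i. dist (w i a) a)"
    and ln_\<Gamma>: "integrable (measure_pmf p) (\<lambda>i. ln (\<Gamma> i))" "(\<integral>i. ln (\<Gamma> i) \<partial>measure_pmf p) < 0"
begin

abbreviation "word n \<omega> \<equiv> foldr w (stake n \<omega>)"
abbreviation "coding \<equiv> ifs_coding w (SOME x. x \<in> X)"
abbreviation "\<mu> \<equiv> ifs_measure X w p"

lemma word_in: "x \<in> X \<Longrightarrow> word n \<omega> x \<in> X"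
  by (induction n arbitrary: \<omega>) (auto intro: maps)

lemma dist_word_le:
  assumes "x \<in> X" "y \<in> X"
  shows "dist (word n \<omega> x) (word n \<omega> y) \<le> (\<Prod>k<n. \<Gamma> (\<omega> !! k)) * dist x y"
proof (induction n arbitrary: \<omega>)
  case (Suc n)
  have "dist (word (Suc n) \<omega> x) (word (Suc n) \<omega> y)
     \<le> \<Gamma> (shd \<omega>) * dist (word n (stl \<omega>) x) (word n (stl \<omega>) y)"
    using assms by (simp add: lipschitz word_in)
  also have "\<dots> \<le> \<Gamma> (shd \<omega>) * ((\<Prod>k<n. \<Gamma> (stl \<omega> !! k)) * dist x y)"
    using \<Gamma>_pos[of "shd \<omega>"] by (intro mult_left_mono Suc) simp
  finally show ?case by (simp add: prod.lessThan_Suc_shift mult.assoc del: prod.lessThan_Suc)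
qed simp

text \<open>\<open>lim\<close> has a value even for a divergent sequence. This predicate says that
  the value is a true limit, and the same from every starting point of \<open>X\<close>.\<close>

definition codable :: "'i stream \<Rightarrow> bool" where
  "codable \<omega> \<longleftrightarrow> (\<forall>x\<in>X. (\<lambda>n. word n \<omega> x) \<longlonglongrightarrow> coding \<omega>)"

lemma coding_eq_limit:
  assumes "x \<in> X" and lim: "\<And>x. x \<in> X \<Longrightarrow> (\<lambda>n. word n \<omega> x) \<longlonglongrightarrow> L"
  shows "coding \<omega> = L" "codable \<omega>"
proof -
  have "(SOME x. x \<in> X) \<in> X" using assms(1) by (rule someI)
  then show "coding \<omega> = L" unfolding ifs_coding_def by (intro limI lim)
  then show "codable \<omega>" unfolding codable_def using lim by simp
qed

text \<open>The limit is required to lie in \<open>X\<close>, which need not be closed, because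
  \<open>w i\<close> is controlled only there; then Lipschitz continuity lets \<open>w i\<close>
  pass through the limit.\<close>

lemma coding_SCons:
  assumes "codable \<omega>" "coding \<omega> \<in> X"
  shows "coding (i ## \<omega>) = w i (coding \<omega>)"
proof (rule coding_eq_limit(1)[OF a])
  fix x assume x: "x \<in> X"
  have "((\<lambda>n. \<Gamma> i * dist (word n \<omega> x) (coding \<omega>)) \<longlongrightarrow> 0) sequentially"
    using assms(1) x unfolding codable_def
    by (intro tendsto_mult_right_zero) (auto simp: tendsto_dist_iff[symmetric])
  then have "(\<lambda>n. w i (word n \<omega> x)) \<longlonglongrightarrow> w i (coding \<omega>)"
    unfolding tendsto_dist_iff[of _ "w i (coding \<omega>)"]
    by (rule Lim_null_comparison[rotated]) (auto intro!: always_eventually lipschitz word_in x assms(2))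
  then have "(\<lambda>n. word (Suc n) (i ## \<omega>) x) \<longlonglongrightarrow> w i (coding \<omega>)" by simp
  then show "(\<lambda>n. word n (i ## \<omega>) x) \<longlonglongrightarrow> w i (coding \<omega>)" by (rule LIMSEQ_imp_Suc)
qed

lemma AE_contraction_rate:
  assumes \<kappa>: "\<kappa> < - (\<integral>i. ln (\<Gamma> i) \<partial>measure_pmf p)"
  shows "AE \<omega> in P. \<exists>C>0. \<forall>n. (\<Prod>k<n. \<Gamma> (\<omega> !! k)) \<le> C * exp (- \<kappa> * n)"
proof -
  have "AE \<omega> in P. \<exists>C. \<forall>n. (\<Sum>k<n. ln (\<Gamma> (\<omega> !! k))) \<le> C + real n * (- \<kappa>)"
    using \<kappa> ln_\<Gamma> by (intro letter_sum_linear_bound) auto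
  then show ?thesis
  proof eventually_elim
    fix \<omega> assume "\<exists>C. \<forall>n. (\<Sum>k<n. ln (\<Gamma> (\<omega> !! k))) \<le> C + real n * (- \<kappa>)"
    then obtain C where C: "\<And>n. (\<Sum>k<n. ln (\<Gamma> (\<omega> !! k))) \<le> C + real n * (- \<kappa>)" by blast
    have "(\<Prod>k<n. \<Gamma> (\<omega> !! k)) \<le> exp C * exp (- \<kappa> * n)" for n
    proof -
      have "(\<Prod>k<n. \<Gamma> (\<omega> !! k)) = exp (\<Sum>k<n. ln (\<Gamma> (\<omega> !! k)))"
        by (simp add: exp_sum \<Gamma>_pos)
      also have "\<dots> \<le> exp (C + real n * (- \<kappa>))" using C by simp
      finally show ?thesis by (simp add: exp_add[symmetric] mult.commute)
    qed
    then show "\<exists>C>0. \<forall>n. (\<Prod>k<n. \<Gamma> (\<omega> !! k)) \<le> C * exp (- \<kappa> * n)" by (intro exI[of _ "exp C"]) auto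
  qed
qed

text \<open>Consecutive approximations are images under \<open>word n \<omega>\<close> of
  \<open>a\<close> and \<open>w (\<omega> !! n) a\<close>. The contraction is exponential, while the
  displacement of \<open>a\<close> by the \<open>n\<close>-th letter grows at most linearly almost
  surely.\<close>

lemma AE_coding_rate:
  assumes \<kappa>: "0 < \<kappa>" "\<kappa> < - (\<integral>i. ln (\<Gamma> i) \<partial>measure_pmf p)"
  shows "AE \<omega> in P. codable \<omega> \<and> (\<exists>C>0. \<forall>n. dist (word n \<omega> a) (coding \<omega>) \<le> C * exp (- \<kappa> * n))"
proof -
  \<comment> \<open>Midway between \<open>\<kappa>\<close> and the true rate; the gap
    \<open>\<kappa>' - \<kappa>\<close> absorbs the linear growth.\<close>
  define \<kappa>' where "\<kappa>' = (\<kappa> - (\<integral>i. ln (\<Gamma> i) \<partial>measure_pmf p)) / 2"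
  have \<kappa>': "\<kappa> < \<kappa>'" "\<kappa>' < - (\<integral>i. ln (\<Gamma> i) \<partial>measure_pmf p)" using \<kappa> by (auto simp: \<kappa>'_def)
  define D where "D = (\<integral>i. dist (w i a) a \<partial>measure_pmf p) + 1"
  have D: "D > 0" unfolding D_def by (intro add_nonneg_pos integral_nonneg_AE) auto
  have "AE \<omega> in P. \<exists>C. \<forall>n. (\<Sum>k<n. dist (w (\<omega> !! k) a) a) \<le> C + real n * D"
    by (intro letter_sum_linear_bound drift) (simp add: D_def)
  with AE_contraction_rate[OF \<kappa>'(2)] show ?thesis
  proof eventually_elim
    fix \<omega>
    assume "\<exists>C>0. \<forall>n. (\<Prod>k<n. \<Gamma> (\<omega> !! k)) \<le> C * exp (- \<kappa>' * n)"
      and "\<exists>C. \<forall>n. (\<Sum>k<n. dist (w (\<omega> !! k) a) a) \<le> C + real n * D"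
    then obtain C1 C2 where C1: "C1 > 0" "\<And>n::nat. (\<Prod>k<n. \<Gamma> (\<omega> !! k)) \<le> C1 * exp (- \<kappa>' * n)"
      and C2: "\<And>n::nat. (\<Sum>k<n. dist (w (\<omega> !! k) a) a) \<le> C2 + real n * D" by blast
    \<comment> \<open>Collects the linear bound after \<open>n\<close> is replaced by the larger
      \<open>exp ((\<kappa>' - \<kappa>) * n) / (\<kappa>' - \<kappa>)\<close>.\<close>
    define C3 where "C3 = \<bar>C2\<bar> + D + D / (\<kappa>' - \<kappa>)"
    have C3: "C3 > 0" using D \<kappa>' by (simp add: C3_def add_nonneg_pos add_pos_nonneg)
    have step: "dist (word (Suc n) \<omega> a) (word n \<omega> a) \<le> C1 * C3 * exp (- \<kappa>) ^ n" for n
    proof -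
      have "dist (w (\<omega> !! n) a) a \<le> (\<Sum>k<Suc n. dist (w (\<omega> !! k) a) a)"
        by (simp add: sum_nonneg)
      also have "\<dots> \<le> (\<bar>C2\<bar> + D) * 1 + D / (\<kappa>' - \<kappa>) * ((\<kappa>' - \<kappa>) * n)"
      proof -
        have *: "D / (\<kappa>' - \<kappa>) * ((\<kappa>' - \<kappa>) * n) = D * n" using \<kappa>' by simp
        have "C2 + real (Suc n) * D \<le> \<bar>C2\<bar> + D + D * n" by (simp add: algebra_simps)
        then show ?thesis unfolding * mult_1_right by (rule order_trans[OF C2])
      qed
      also have "\<dots> \<le> (\<bar>C2\<bar> + D) * exp ((\<kappa>' - \<kappa>) * n) + D / (\<kappa>' - \<kappa>) * exp ((\<kappa>' - \<kappa>) * n)"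
      proof -
        have "(\<kappa>' - \<kappa>) * n \<le> exp ((\<kappa>' - \<kappa>) * n)"
          using exp_ge_add_one_self[of "(\<kappa>' - \<kappa>) * n"] by linarith
        then show ?thesis using D \<kappa>' by (intro add_mono mult_left_mono) auto
      qed
      also have "\<dots> = C3 * exp ((\<kappa>' - \<kappa>) * n)" by (simp add: C3_def algebra_simps)
      finally have d: "dist (w (\<omega> !! n) a) a \<le> C3 * exp ((\<kappa>' - \<kappa>) * n)" .
      have "dist (word (Suc n) \<omega> a) (word n \<omega> a) = dist (word n \<omega> (w (\<omega> !! n) a)) (word n \<omega> a)"
        by (simp add: stake_Suc del: stake.simps)
      also have "\<dots> \<le> (\<Prod>k<n. \<Gamma> (\<omega> !! k)) * dist (w (\<omega> !! n) a) a"
        by (intro dist_word_le maps a)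
      also have "\<dots> \<le> (C1 * exp (- \<kappa>' * n)) * (C3 * exp ((\<kappa>' - \<kappa>) * n))"
        using C1 C3 by (intro mult_mono d C1) auto
      also have "\<dots> = C1 * C3 * exp (- \<kappa>) ^ n"
        by (simp add: exp_add[symmetric] exp_of_nat_mult[symmetric] algebra_simps)
      finally show ?thesis .
    qed
    have q: "exp (- \<kappa>) < 1" using \<kappa> by simp
    obtain L where L: "(\<lambda>n. word n \<omega> a) \<longlonglongrightarrow> L"
      and rate: "\<And>n. dist (word n \<omega> a) L \<le> C1 * C3 / (1 - exp (- \<kappa>)) * exp (- \<kappa>) ^ n"
      using geometric_steps_imp_convergent[of "exp (- \<kappa>)" "\<lambda>n. word n \<omega> a", OF _ q step] by auto
    \<comment> \<open>The contraction brings the images of \<open>x\<close> and \<open>a\<close>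
      together, so the limit does not depend on the starting point.\<close>
    have "(\<lambda>n. word n \<omega> x) \<longlonglongrightarrow> L" if x: "x \<in> X" for x
    proof (rule Lim_transform[OF L])
      have "(\<lambda>n::nat. (C1 * exp (- \<kappa>') ^ n) * dist x a) \<longlonglongrightarrow> 0"
        using \<kappa> \<kappa>' by (intro tendsto_mult_left_zero tendsto_mult_right_zero LIMSEQ_realpow_zero) auto
      then have "(\<lambda>n. dist (word n \<omega> x) (word n \<omega> a)) \<longlonglongrightarrow> 0"
      proof (rule Lim_null_comparison[rotated], intro always_eventually allI)
        fix n
        have "dist (word n \<omega> x) (word n \<omega> a) \<le> (\<Prod>k<n. \<Gamma> (\<omega> !! k)) * dist x a"
          by (intro dist_word_le x a)
        also have "\<dots> \<le> (C1 * exp (- \<kappa>' * n)) * dist x a" by (intro mult_right_mono C1) auto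
        finally show "norm (dist (word n \<omega> x) (word n \<omega> a)) \<le> (C1 * exp (- \<kappa>') ^ n) * dist x a"
          by (simp add: exp_of_nat_mult[symmetric] mult.commute)
      qed
      then show "(\<lambda>n. word n \<omega> x - word n \<omega> a) \<longlonglongrightarrow> 0"
        by (simp only: dist_norm tendsto_norm_zero_iff)
    qed
    from coding_eq_limit[OF a this] rate C1 C3 q
    show "codable \<omega> \<and> (\<exists>C>0. \<forall>n. dist (word n \<omega> a) (coding \<omega>) \<le> C * exp (- \<kappa> * n))"
      by (auto intro!: exI[of _ "C1 * C3 / (1 - exp (- \<kappa>))"] simp: exp_of_nat_mult[symmetric] mult.commute)
  qed
qed

text \<open>Each approximation depends only on a finite word over a countable alphabet.\<close>

lemma measurable_coding [measurable]: "coding \<in> borel_measurable P"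
  unfolding ifs_coding_def
proof (rule borel_measurable_lim_metric)
  fix n
  have "stake n \<in> measurable P (count_space UNIV)"
    using measurable_stake measurable_cong_sets[OF sets_P refl] by blast
  then show "(\<lambda>\<omega>. word n \<omega> (SOME x. x \<in> X)) \<in> borel_measurable P"
    by (rule measurable_compose) simp
qed

lemma sets_\<mu> [simp]: "sets \<mu> = sets borel"
  by (simp add: ifs_measure_def)

lemma prob_space_\<mu>: "prob_space \<mu>"
  unfolding ifs_measure_def by (intro P.prob_space_distr) simp

lemma emeasure_\<mu>: "B \<in> sets borel \<Longrightarrow> emeasure \<mu> B = emeasure P (coding -` B)"
  unfolding ifs_measure_def by (subst emeasure_distr) auto

end

section \<open>Local mass of the invariant measure and the packing bound from above\<close>

locale ifs_with_invariant_set = average_contracting_ifs p X w \<Gamma> a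
  for p :: "'i::countable pmf" and X :: "'a::euclidean_space set" and w \<Gamma> a +
  fixes U :: "'a set"
  assumes U: "U \<subseteq> X" "U \<in> sets borel" "\<And>i x. x \<in> U \<Longrightarrow> w i x \<in> U" "emeasure \<mu> U > 0"
begin

text \<open>By ergodicity almost every orbit of the shift reaches a code of a point of
  \<open>U\<close>. Since every \<open>w i\<close> maps \<open>U\<close> into itself, membership is
  carried back to the start of the code.\<close>

lemma AE_coding_in_U: "AE \<omega> in P. \<forall>k. codable (sdrop k \<omega>) \<and> coding (sdrop k \<omega>) \<in> U"
proof (rule AE_sdrop)
  have "AE \<omega> in P. codable \<omega>"
    using AE_coding_rate[of "- (\<integral>i. ln (\<Gamma> i) \<partial>measure_pmf p) / 2"] ln_\<Gamma>(2) by (auto simp: field_simps)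
  then have "AE \<omega> in P. \<forall>k. codable (sdrop k \<omega>)" by (rule AE_sdrop)
  moreover have "AE \<omega> in P. \<exists>k. (stl ^^ k) \<omega> \<in> coding -` U"
    using U measurable_sets[OF measurable_coding U(2)]
    by (intro P.AE_visits) (auto simp: emeasure_\<mu> P.emeasure_eq_measure)
  ultimately show "AE \<omega> in P. codable \<omega> \<and> coding \<omega> \<in> U"
  proof eventually_elim
    fix \<omega> assume cod: "\<forall>k. codable (sdrop k \<omega>)" and "\<exists>k. (stl ^^ k) \<omega> \<in> coding -` U"
    then obtain k where k: "coding (sdrop k \<omega>) \<in> U" by (auto simp: sdrop_eq_funpow)
    \<comment> \<open>Downward induction from the visiting time \<open>k\<close> to time 0.\<close>
    have "coding (sdrop (k - j) \<omega>) \<in> U" if "j \<le> k" for j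
      using that
    proof (induction j)
      case (Suc j)
      then have *: "sdrop (k - Suc j) \<omega> = (\<omega> !! (k - Suc j)) ## sdrop (k - j) \<omega>"
        by (metis Suc_diff_Suc Suc_le_lessD id_stake_snth_sdrop sdrop_simps(1) sdrop_simps(2) stream.collapse)
      have "coding (sdrop (k - j) \<omega>) \<in> U" using Suc by simp
      then show ?case unfolding * using cod U(1,3) by (subst coding_SCons) auto
    qed (simp add: k)
    from this[of k] cod show "codable \<omega> \<and> coding \<omega> \<in> U" by (auto dest: spec[of _ 0])
  qed
qed

lemma coding_eq_word_coding:
  assumes "\<forall>k. codable (sdrop k \<omega>) \<and> coding (sdrop k \<omega>) \<in> U"
  shows "coding \<omega> = word n \<omega> (coding (sdrop n \<omega>))"
  using assms
proof (induction n arbitrary: \<omega>)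
  case (Suc n)
  have stl: "\<forall>k. codable (sdrop k (stl \<omega>)) \<and> coding (sdrop k (stl \<omega>)) \<in> U"
    using Suc.prems by (metis sdrop.simps(2))
  have "coding \<omega> = coding (shd \<omega> ## stl \<omega>)" by simp
  also have "\<dots> = w (shd \<omega>) (coding (stl \<omega>))"
    using stl[rule_format, of 0] U(1) by (subst coding_SCons) auto
  also have "coding (stl \<omega>) = word n (stl \<omega>) (coding (sdrop n (stl \<omega>)))"
    using stl by (rule Suc.IH)
  finally show ?case by simp
qed simp

text \<open>Among the codes that begin like \<open>\<omega>\<close>, those whose tail is coded into
  a fixed ball around \<open>a\<close> form a proportion independent of \<open>n\<close>.
  Contraction along the common word places their points near \<open>coding \<omega>\<close>. One
  natural number serves for both constants, so that countably many sets exhaust the measure.\<close>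

lemma AE_local_mass:
  fixes h \<kappa> :: real
  assumes p_pos: "\<And>i. pmf p i > 0" and ln_p: "integrable (measure_pmf p) (\<lambda>i. ln (pmf p i))"
    and h: "- (\<integral>i. ln (pmf p i) \<partial>measure_pmf p) < h"
    and \<kappa>: "0 < \<kappa>" "\<kappa> < - (\<integral>i. ln (\<Gamma> i) \<partial>measure_pmf p)"
  shows "AE \<omega> in P. \<exists>N::nat. 0 < real N \<and>
    (\<forall>n::nat. exp (- h * n) / N \<le> measure \<mu> (cball (coding \<omega>) (N * exp (- \<kappa> * n))))"
proof -
  interpret \<mu>: prob_space \<mu> by (rule prob_space_\<mu>)
  define D where "D R = coding -` cball a (real R)" for R :: nat
  have D [measurable]: "D R \<in> sets P" for R
    unfolding D_def using measurable_sets[OF measurable_coding, of "cball a (real R)"] by simp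
  have "\<exists>R. emeasure P (D R) > 0"
  proof (rule ccontr)
    assume "\<nexists>R. emeasure P (D R) > 0"
    then have "emeasure P (\<Union>R. D R) = 0" by (intro emeasure_UN_eq_0) auto
    moreover have "(\<Union>R. D R) = UNIV" by (auto simp: D_def intro: real_arch_simple)
    ultimately show False by simp
  qed
  then obtain R where R: "P.prob (D R) > 0" by (auto simp: P.emeasure_eq_measure)
  define p0 where "p0 = P.prob (D R)"
  have "AE \<omega> in P. \<exists>C. \<forall>n::nat. (\<Sum>k<n. - ln (pmf p (\<omega> !! k))) \<le> C + real n * h"
    using ln_p h by (intro letter_sum_linear_bound) auto
  with AE_contraction_rate[OF \<kappa>(2)] AE_coding_rate[OF \<kappa>] show ?thesis
  proof eventually_elim
    fix \<omega>
    assume "\<exists>C>0. \<forall>n. (\<Prod>k<n. \<Gamma> (\<omega> !! k)) \<le> C * exp (- \<kappa> * n)"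
      and "codable \<omega> \<and> (\<exists>C>0. \<forall>n. dist (word n \<omega> a) (coding \<omega>) \<le> C * exp (- \<kappa> * n))"
      and "\<exists>C. \<forall>n. (\<Sum>k<n. - ln (pmf p (\<omega> !! k))) \<le> C + real n * h"
    then obtain C1 C2 C3 where C1: "C1 > 0" "\<And>n::nat. (\<Prod>k<n. \<Gamma> (\<omega> !! k)) \<le> C1 * exp (- \<kappa> * n)"
      and C2: "C2 > 0" "\<And>n::nat. dist (word n \<omega> a) (coding \<omega>) \<le> C2 * exp (- \<kappa> * n)"
      and C3: "\<And>n::nat. (\<Sum>k<n. - ln (pmf p (\<omega> !! k))) \<le> C3 + real n * h" by blast
    \<comment> \<open>The first bound is for the radius, the second for the mass.\<close>
    obtain N :: nat where N: "N \<ge> C1 * R + C2" "N \<ge> exp C3 / p0" "N \<ge> 1"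
      using real_arch_simple[of "max (max (C1 * R + C2) (exp C3 / p0)) 1"] by auto
    have "exp (- h * n) / N \<le> measure \<mu> (cball (coding \<omega>) (N * exp (- \<kappa> * n)))" for n :: nat
    proof -
      let ?B = "cball (coding \<omega>) (N * exp (- \<kappa> * n))"
      have "exp (- h * n) / N \<le> exp (- C3 - h * n) * p0"
      proof -
        have "exp C3 \<le> N * p0" using N(2) R by (simp add: p0_def field_simps)
        then have "exp (- h * n) * exp (- C3) * exp C3 \<le> exp (- h * n) * exp (- C3) * (N * p0)"
          by (intro mult_left_mono) auto
        then show ?thesis using N(3) by (simp add: field_simps exp_diff exp_minus)
      qed
      also have "exp (- C3 - h * n) \<le> exp (\<Sum>k<n. ln (pmf p (\<omega> !! k)))"
        using C3[of n] by (simp add: sum_negf algebra_simps)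
      also have "\<dots> = (\<Prod>k<n. pmf p (\<omega> !! k))"
        by (simp add: exp_sum p_pos)
      finally have "exp (- h * n) / N \<le> (\<Prod>k<n. pmf p (\<omega> !! k)) * p0"
        using R by (simp add: p0_def)
      then have "ennreal (exp (- h * n) / N) \<le> ennreal (\<Prod>k<n. pmf p (\<omega> !! k)) * emeasure P (D R)"
        by (simp add: P.emeasure_eq_measure p0_def ennreal_mult'[symmetric] prod_nonneg)
      also have "\<dots> = emeasure P (sstart UNIV (stake n \<omega>) \<inter> sdrop (length (stake n \<omega>)) -` D R)"
        by (subst emeasure_stream_space_sstart_Int_sdrop[OF D]) (simp add: emeasure_sstart)
      also have "\<dots> \<le> emeasure P (coding -` ?B)"
      \<comment> \<open>Splitting a code into its prefix and its tail is justified only if all tails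
        are coded into \<open>U\<close>, so the inclusion holds almost everywhere.\<close>
      proof (rule emeasure_mono_AE)
        show "AE \<eta> in P. \<eta> \<in> sstart UNIV (stake n \<omega>) \<inter> sdrop (length (stake n \<omega>)) -` D R
               \<longrightarrow> \<eta> \<in> coding -` ?B"
          using AE_coding_in_U
        proof eventually_elim
          fix \<eta> assume \<eta>: "\<forall>k. codable (sdrop k \<eta>) \<and> coding (sdrop k \<eta>) \<in> U"
          show "\<eta> \<in> sstart UNIV (stake n \<omega>) \<inter> sdrop (length (stake n \<omega>)) -` D R \<longrightarrow> \<eta> \<in> coding -` ?B"
          proof
            assume *: "\<eta> \<in> sstart UNIV (stake n \<omega>) \<inter> sdrop (length (stake n \<omega>)) -` D R"
            let ?y = "coding (sdrop n \<eta>)"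
            have "stake n \<eta> = stake n \<omega>"
              using * by (intro nth_equalityI) (auto simp: sstart_eq)
            then have "coding \<eta> = word n \<omega> ?y" using coding_eq_word_coding[OF \<eta>, of n] by simp
            moreover have "?y \<in> X" using \<eta> U(1) by auto
            then have "dist (word n \<omega> ?y) (word n \<omega> a) \<le> (\<Prod>k<n. \<Gamma> (\<omega> !! k)) * dist ?y a"
              using a by (rule dist_word_le)
            moreover have "\<dots> \<le> C1 * exp (- \<kappa> * n) * R"
              using * C1 by (intro mult_mono) (auto simp: D_def dist_commute)
            ultimately have "dist (coding \<omega>) (coding \<eta>) \<le> C2 * exp (- \<kappa> * n) + C1 * exp (- \<kappa> * n) * R"
              using C2(2)[of n] dist_triangle[of "coding \<omega>" "coding \<eta>" "word n \<omega> a"]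
              by (simp add: dist_commute)
            also have "\<dots> = (C1 * R + C2) * exp (- \<kappa> * n)" by (simp add: algebra_simps)
            also have "\<dots> \<le> N * exp (- \<kappa> * n)" using N by (intro mult_right_mono) auto
            finally show "\<eta> \<in> coding -` ?B" by simp
          qed
        qed
        show "coding -` ?B \<in> sets P"
          using measurable_sets[OF measurable_coding, of ?B] by simp
      qed
      also have "\<dots> = emeasure \<mu> ?B" by (simp add: emeasure_\<mu>)
      finally show ?thesis by (simp add: \<mu>.emeasure_eq_measure)
    qed
    moreover have "0 < real N" using N(3) by simp
    ultimately show "\<exists>N::nat. 0 < real N \<and>
        (\<forall>n::nat. exp (- h * n) / N \<le> measure \<mu> (cball (coding \<omega>) (N * exp (- \<kappa> * n))))"
      by blast
  qed
qed

text \<open>The balls are the sections of one measurable set of pairs.\<close>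

lemma measurable_measure_cball: "(\<lambda>x. measure \<mu> (cball x r)) \<in> borel_measurable borel"
proof -
  interpret \<mu>: prob_space \<mu> by (rule prob_space_\<mu>)
  have "{z. dist (fst z) (snd z) \<le> r} \<in> sets (borel \<Otimes>\<^sub>M (borel :: 'a measure))"
  proof -
    have "{z \<in> space (borel \<Otimes>\<^sub>M (borel :: 'a measure)). dist (fst z) (snd z) \<le> r} \<in> sets (borel \<Otimes>\<^sub>M borel)"
      by measurable
    then show ?thesis by (simp add: space_pair_measure)
  qed
  then have "{z. dist (fst z) (snd z) \<le> r} \<in> sets (borel \<Otimes>\<^sub>M \<mu>)"
    using sets_pair_measure_cong[OF refl sets_\<mu>] by blast
  from \<mu>.measurable_emeasure_Pair[OF this]
  have "(\<lambda>x. emeasure \<mu> (cball x r)) \<in> borel_measurable borel"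
    by (simp add: cball_def vimage_def)
  then show ?thesis unfolding measure_def by measurable
qed

text \<open>Rates slightly worse than the true ones still have quotient below \<open>t\<close>. The
  sets where the local mass bound holds with a fixed constant then have \<open>t\<close>-premeasure
  0, and their union has full measure.\<close>

lemma exists_full_measure_packing_dim_le:
  assumes p_pos: "\<And>i. pmf p i > 0" and ln_p: "integrable (measure_pmf p) (\<lambda>i. ln (pmf p i))"
    and t: "(\<integral>i. ln (pmf p i) \<partial>measure_pmf p) / (\<integral>i. ln (\<Gamma> i) \<partial>measure_pmf p) < t"
  shows "\<exists>E\<in>sets \<mu>. emeasure \<mu> E = 1 \<and> packing_dim E \<le> t"
proof -
  interpret \<mu>: prob_space \<mu> by (rule prob_space_\<mu>)
  define h0 where "h0 = - (\<integral>i. ln (pmf p i) \<partial>measure_pmf p)"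
  define \<kappa>0 where "\<kappa>0 = - (\<integral>i. ln (\<Gamma> i) \<partial>measure_pmf p)"
  have h0: "h0 \<ge> 0"
    unfolding h0_def using p_pos
    by (subst Bochner_Integration.integral_minus[symmetric])
      (intro integral_nonneg_AE always_eventually, auto simp: pmf_le_1)
  have \<kappa>0: "\<kappa>0 > 0" using ln_\<Gamma>(2) by (simp add: \<kappa>0_def)
  have t0: "h0 / \<kappa>0 < t" using t by (simp add: h0_def \<kappa>0_def)
  \<comment> \<open>The perturbed quotient is continuous at 0, so it stays below \<open>t\<close>
    for small positive \<open>e\<close>.\<close>
  have "((\<lambda>e. (h0 + e) / (\<kappa>0 - e)) \<longlongrightarrow> (h0 + 0) / (\<kappa>0 - 0)) (at_right 0)"
    using \<kappa>0 by (intro tendsto_intros) auto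
  then have "\<forall>\<^sub>F e in at_right 0. (h0 + e) / (\<kappa>0 - e) < t"
    using t0 by (intro order_tendstoD(2)) auto
  moreover have "\<forall>\<^sub>F e in at_right 0. e \<in> {0<..<\<kappa>0}"
    using \<kappa>0 by (rule eventually_at_right_real)
  ultimately have "\<forall>\<^sub>F e in at_right 0. (h0 + e) / (\<kappa>0 - e) < t \<and> 0 < e \<and> e < \<kappa>0"
    by eventually_elim auto
  then obtain e where e: "(h0 + e) / (\<kappa>0 - e) < t" "0 < e" "e < \<kappa>0"
    by (auto dest!: eventually_happens)
  define h where "h = h0 + e"
  define \<kappa> where "\<kappa> = \<kappa>0 - e"
  have h: "h > 0" "h0 < h" and \<kappa>: "0 < \<kappa>" "\<kappa> < \<kappa>0" and ht: "h / \<kappa> < t"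
    using e h0 by (auto simp: h_def \<kappa>_def)
  have t_pos: "t > 0" using h \<kappa> ht by (smt (verit) divide_pos_pos)
  \<comment> \<open>\<open>Suc N\<close> keeps the constant positive for every index.\<close>
  define F where "F N = {x. \<forall>n::nat. exp (- h * n) / Suc N \<le> measure \<mu> (cball x (Suc N * exp (- \<kappa> * n)))}" for N
  have F [measurable]: "F N \<in> sets borel" for N
  proof -
    define S where "S n = (\<lambda>x. measure \<mu> (cball x (Suc N * exp (- \<kappa> * n)))) -` {exp (- h * n) / Suc N..} \<inter> space borel"
      for n :: nat
    have "S n \<in> sets borel" for n
      unfolding S_def by (rule measurable_sets[OF measurable_measure_cball]) simp
    moreover have "F N = (\<Inter>n. S n)" by (auto simp: F_def S_def)
    ultimately show ?thesis by auto
  qed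
  have "AE \<omega> in P. coding \<omega> \<in> (\<Union>N. F N)"
    using AE_local_mass[OF p_pos ln_p h(2)[unfolded h0_def] \<kappa>[unfolded \<kappa>0_def]]
  proof eventually_elim
    fix \<omega> assume "\<exists>N::nat. 0 < real N \<and> (\<forall>n::nat. exp (- h * n) / N \<le> measure \<mu> (cball (coding \<omega>) (N * exp (- \<kappa> * n))))"
    then obtain N :: nat where N: "0 < real N \<and> (\<forall>n::nat. exp (- h * n) / N \<le> measure \<mu> (cball (coding \<omega>) (N * exp (- \<kappa> * n))))" ..
    then obtain M where "N = Suc M" by (cases N) auto
    with N have "coding \<omega> \<in> F M" unfolding F_def by blast
    then show "coding \<omega> \<in> (\<Union>N. F N)" by blast
  qed
  then have "emeasure P (coding -` (\<Union>N. F N)) = 1"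
    using P.emeasure_eq_1_AE[of "coding -` (\<Union>N. F N)"] measurable_sets[OF measurable_coding, of "\<Union>N. F N"]
    by simp
  then have full: "emeasure \<mu> (\<Union>N. F N) = 1" by (simp add: emeasure_\<mu>)
  have "packing_premeasure t (F N) = 0" for N
  proof (rule packing_premeasure_eq_0[OF _ sets_\<mu> _ ht])
    show "finite_measure \<mu>" by unfold_locales
    \<comment> \<open>The factor \<open>exp (- h)\<close> pays for rounding \<open>n\<close> up, the
      power of \<open>Suc N\<close> for the factor in the radius.\<close>
    let ?c = "exp (- h) / Suc N * Suc N powr (- (h / \<kappa>))"
    show "0 < ?c" by simp
    fix x r assume x: "x \<in> F N" and r: "0 < r" "r \<le> (1::real)"
    \<comment> \<open>The least \<open>n\<close> with
      \<open>Suc N * exp (- \<kappa> * n) \<le> r\<close>. As \<open>r \<le> 1\<close>, the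
      logarithm is nonnegative and \<open>nat\<close> truncates nothing.\<close>
    define n where "n = nat \<lceil>ln (Suc N / r) / \<kappa>\<rceil>"
    have ln_nonneg: "ln (Suc N / r) \<ge> 0" using r by (intro ln_ge_zero) (simp add: field_simps)
    have n_ge: "ln (Suc N / r) / \<kappa> \<le> n" unfolding n_def by linarith
    have "ln (Suc N / r) / \<kappa> \<ge> 0" using ln_nonneg \<kappa> by simp
    then have n_le: "n \<le> ln (Suc N / r) / \<kappa> + 1" unfolding n_def by linarith
    have "?c * r powr (h / \<kappa>) = exp (- h) / Suc N * exp (- (h / \<kappa>) * ln (Suc N / r))"
      using r by (simp add: powr_def exp_add[symmetric] ln_div algebra_simps)
    also have "\<dots> = exp (- h * (ln (Suc N / r) / \<kappa> + 1)) / Suc N"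
      by (simp add: exp_add[symmetric] algebra_simps)
    also have "\<dots> \<le> exp (- h * n) / Suc N"
      using n_le h by (intro divide_right_mono) auto
    also have "\<dots> \<le> measure \<mu> (cball x (Suc N * exp (- \<kappa> * n)))"
      using x by (auto simp: F_def)
    also have "\<dots> \<le> measure \<mu> (cball x r)"
    proof (intro \<mu>.finite_measure_mono subset_cball)
      have "ln (Suc N / r) \<le> \<kappa> * n" using n_ge \<kappa> by (simp add: field_simps)
      then have "Suc N / r \<le> exp (\<kappa> * n)" using r by (metis exp_le_cancel_iff exp_ln divide_pos_pos of_nat_0_less_iff zero_less_Suc)
      then show "Suc N * exp (- \<kappa> * n) \<le> r" using r by (simp add: exp_minus field_simps)
    qed simp
    finally show "?c * r powr (h / \<kappa>) \<le> measure \<mu> (cball x r)" .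
  qed
  then have "packing_measure t (\<Union>N. F N) = 0" by (intro packing_measure_eq_0) auto
  with full t_pos show ?thesis
    by (intro bexI[of _ "\<Union>N. F N"]) (auto intro: packing_dim_le)
qed

end

subsection \<open>The lower bound\<close>

locale separated_ifs = ifs_with_invariant_set p X w \<Gamma> a U
  for p :: "'i::countable pmf" and X :: "'a::euclidean_space set" and w \<Gamma> a U +
  fixes \<gamma> :: "'i \<Rightarrow> real"
  assumes p_pos: "\<And>i. pmf p i > 0"
    and \<gamma>_pos: "\<And>i. \<gamma> i > 0"
    and expansion: "\<And>i x y. x \<in> X \<Longrightarrow> y \<in> X \<Longrightarrow> \<gamma> i * dist x y \<le> dist (w i x) (w i y)"
    and disjoint: "\<And>i j. i \<noteq> j \<Longrightarrow> w i ` U \<inter> w j ` U = {}"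
    and ln_p: "integrable (measure_pmf p) (\<lambda>i. ln (pmf p i))"
    and ln_\<gamma>: "integrable (measure_pmf p) (\<lambda>i. ln (\<gamma> i))"
begin

definition good :: "'i set \<Rightarrow> 'a set \<Rightarrow> 'i stream \<Rightarrow> bool" where
  "good J L \<omega> \<longleftrightarrow> shd \<omega> \<in> J \<and> coding (stl \<omega>) \<in> L"

text \<open>A bet with stake 1: \<open>\<alpha>\<close> goes on the one letter that a good step can
  have, at the fair odds \<open>1 / pmf p i\<close>, and \<open>1 - \<alpha>\<close> is kept for a
  bad step.\<close>

definition gain :: "'i set \<Rightarrow> 'a set \<Rightarrow> real \<Rightarrow> 'i stream \<Rightarrow> real" where
  "gain J L \<alpha> \<omega> = (if good J L \<omega> then \<alpha> / pmf p (shd \<omega>) else 1 - \<alpha>)"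

text \<open>
  Pulling back a set of diameter at most \<open>d\<close> along fewer than \<open>n\<close> letters of \<open>\<omega>\<close> keeps its diameter
  below the separation \<open>\<rho>\<close>.
\<close>

definition resolved :: "real \<Rightarrow> nat \<Rightarrow> real \<Rightarrow> 'i stream \<Rightarrow> bool" where
  "resolved \<rho> n d \<omega> \<longleftrightarrow> (\<forall>k<n. d < \<rho> * (\<Prod>j<k. \<gamma> (\<omega> !! j)))"

text \<open>The index 0 gives \<open>d < \<rho>\<close>; in the later conditions the factor
  \<open>\<gamma> i\<close> moves to the left.\<close>

lemma resolved_SCons:
  "resolved \<rho> (Suc n) d (i ## \<omega>) \<longleftrightarrow> d < \<rho> \<and> resolved \<rho> n (d / \<gamma> i) \<omega>"
proof -
  have "d < \<rho> * (\<Prod>j<Suc k. \<gamma> ((i ## \<omega>) !! j)) \<longleftrightarrow> d / \<gamma> i < \<rho> * (\<Prod>j<k. \<gamma> (\<omega> !! j))" for k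
    using \<gamma>_pos[of i] by (simp add: prod.lessThan_Suc_shift field_simps del: prod.lessThan_Suc)
  then show ?thesis
    unfolding resolved_def by (auto simp: less_Suc_eq_0_disj simp del: prod.lessThan_Suc)
qed

lemma measurable_good [measurable]:
  assumes [measurable]: "L \<in> sets borel"
  shows "Measurable.pred P (good J L)"
proof -
  have [measurable]: "Measurable.pred P (\<lambda>\<omega>. shd \<omega> \<in> J)"
    by (rule measurable_compose[OF measurable_shd]) simp
  have [measurable]: "(\<lambda>\<omega>. coding (stl \<omega>)) \<in> borel_measurable P"
    by (rule measurable_compose[OF measurable_stl measurable_coding])
  show ?thesis unfolding good_def by measurable
qed

lemma measurable_gain [measurable]:
  assumes [measurable]: "L \<in> sets borel"
  shows "gain J L \<alpha> \<in> borel_measurable P"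
proof -
  have [measurable]: "(\<lambda>\<omega>. \<alpha> / pmf p (shd \<omega>)) \<in> borel_measurable P"
    by (rule measurable_compose[OF measurable_shd]) simp
  show ?thesis unfolding gain_def by measurable
qed

lemma measurable_resolved [measurable]: "Measurable.pred P (resolved \<rho> n d)"
  unfolding resolved_def by measurable

lemma gain_pos: "0 < \<alpha> \<Longrightarrow> \<alpha> < 1 \<Longrightarrow> 0 < gain J L \<alpha> \<omega>"
  using p_pos by (simp add: gain_def)

definition gain_product :: "'i set \<Rightarrow> 'a set \<Rightarrow> real \<Rightarrow> nat \<Rightarrow> 'i stream \<Rightarrow> real" where
  "gain_product J L \<alpha> n \<omega> = (\<Prod>k<n. gain J L \<alpha> (sdrop k \<omega>))"

lemma gain_product_SCons:
  "gain_product J L \<alpha> (Suc n) (i ## \<omega>) = gain J L \<alpha> (i ## \<omega>) * gain_product J L \<alpha> n \<omega>"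
  unfolding gain_product_def by (simp add: prod.lessThan_Suc_shift del: prod.lessThan_Suc)

lemma measurable_gain_product [measurable]:
  assumes "L \<in> sets borel"
  shows "gain_product J L \<alpha> n \<in> borel_measurable P"
  unfolding gain_product_def
  using measurable_compose[OF measurable_sdrop measurable_gain[OF assms]] by measurable

text \<open>Induction on \<open>n\<close>, splitting off the first letter. By separation at most one
  letter of \<open>J\<close> maps a point of \<open>L\<close> into \<open>V\<close>, so the mean of
  the first gain is at most \<open>(1 - \<alpha>) + \<alpha>\<close>. The remaining product is
  handled by the induction hypothesis for the pullback of \<open>V\<close>, whose distances are at
  most \<open>d / \<gamma> i\<close>.\<close>

lemma gain_product_integral_le_1:
  assumes L: "L \<subseteq> U" "L \<in> sets borel" and \<alpha>: "0 < \<alpha>" "\<alpha> < 1"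
    and sep: "\<And>i j x y. i \<in> J \<Longrightarrow> j \<in> J \<Longrightarrow> i \<noteq> j \<Longrightarrow> x \<in> L \<Longrightarrow> y \<in> L \<Longrightarrow> \<rho> \<le> dist (w i x) (w j y)"
    and V: "closed V" "\<And>x y. x \<in> V \<Longrightarrow> y \<in> V \<Longrightarrow> dist x y \<le> d"
  shows "(\<integral>\<^sup>+\<omega>. indicator {\<omega>. coding \<omega> \<in> V \<and> resolved \<rho> n d \<omega>} \<omega> * ennreal (gain_product J L \<alpha> n \<omega>) \<partial>P) \<le> 1"
  using V
proof (induction n arbitrary: V d)
  case 0
  have "(\<integral>\<^sup>+\<omega>. indicator {\<omega>. coding \<omega> \<in> V \<and> resolved \<rho> 0 d \<omega>} \<omega> * ennreal (gain_product J L \<alpha> 0 \<omega>) \<partial>P)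
      \<le> (\<integral>\<^sup>+\<omega>. 1 \<partial>P)"
    by (intro nn_integral_mono) (auto simp: gain_product_def split: split_indicator)
  then show ?case by simp
next
  case (Suc n)
  define H where "H V d n \<omega> = indicator {\<omega>. coding \<omega> \<in> V \<and> resolved \<rho> n d \<omega>} \<omega> * ennreal (gain_product J L \<alpha> n \<omega>)"
    for V d n \<omega>
  have H_meas [measurable]: "H V d n \<in> borel_measurable P" if "closed V" for V d n
  proof -
    have [measurable]: "V \<in> sets borel" using that by simp
    note L(2)[measurable]
    show ?thesis unfolding H_def by measurable
  qed
  show ?case
  proof (cases "d < \<rho>")
    case False
    \<comment> \<open>The condition \<open>resolved\<close> already fails at index 0, so the
      integrand vanishes.\<close>
    then have "(\<integral>\<^sup>+\<omega>. H V d (Suc n) \<omega> \<partial>P) = (\<integral>\<^sup>+\<omega>. 0 \<partial>P)"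
      by (intro nn_integral_cong) (auto simp: H_def resolved_def split: split_indicator dest: spec[of _ 0])
    then show ?thesis by (simp add: H_def)
  next
    case True
    define A where "A = {i \<in> J. \<exists>x\<in>L. w i x \<in> V}"
    have A_unique: "i = j" if "i \<in> A" "j \<in> A" for i j
    proof (rule ccontr)
      assume "i \<noteq> j"
      from that obtain x y where xy: "i \<in> J" "j \<in> J" "x \<in> L" "y \<in> L" "w i x \<in> V" "w j y \<in> V" by (auto simp: A_def)
      then have "\<rho> \<le> dist (w i x) (w j y)" using \<open>i \<noteq> j\<close> by (intro sep)
      moreover have "dist (w i x) (w j y) \<le> d" using xy by (intro Suc.prems)
      ultimately show False using True by simp
    qed
    have inner: "(\<integral>\<^sup>+\<omega>. H V d (Suc n) (i ## \<omega>) \<partial>P)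
        \<le> ennreal (1 - \<alpha>) + ennreal (\<alpha> / pmf p i) * indicator A i" for i
    proof -
      \<comment> \<open>The induction hypothesis asks for a closed set; taking the closure preserves
        the bound on distances.\<close>
      define V' where "V' = closure {x \<in> U. w i x \<in> V}"
      have V': "closed V'" by (simp add: V'_def)
      have d': "dist x y \<le> d / \<gamma> i" if "x \<in> V'" "y \<in> V'" for x y
      proof -
        have *: "dist x y \<le> d / \<gamma> i" if "x \<in> U" "w i x \<in> V" "y \<in> U" "w i y \<in> V" for x y
        proof -
          have "\<gamma> i * dist x y \<le> d"
            using that U(1) by (intro order_trans[OF expansion Suc.prems(2)]) auto
          then show ?thesis using \<gamma>_pos[of i] by (simp add: field_simps)
        qed
        have "closure ({x \<in> U. w i x \<in> V} \<times> {x \<in> U. w i x \<in> V}) \<subseteq> {z. dist (fst z) (snd z) \<le> d / \<gamma> i}"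
          by (intro closure_minimal closed_Collect_le continuous_intros) (auto intro: *)
        then show ?thesis using that by (auto simp: closure_Times V'_def)
      qed
      \<comment> \<open>Bounds the first gain uniformly in the tail: a good step into
        \<open>V\<close> forces \<open>i \<in> A\<close>.\<close>
      let ?c = "ennreal (1 - \<alpha>) + ennreal (\<alpha> / pmf p i) * indicator A i"
      have "(\<integral>\<^sup>+\<omega>. H V d (Suc n) (i ## \<omega>) \<partial>P) \<le> (\<integral>\<^sup>+\<omega>. ?c * H V' (d / \<gamma> i) n \<omega> \<partial>P)"
      proof (rule nn_integral_mono_AE)
        show "AE \<omega> in P. H V d (Suc n) (i ## \<omega>) \<le> ?c * H V' (d / \<gamma> i) n \<omega>"
          using AE_coding_in_U
        proof eventually_elim
          fix \<omega> assume "\<forall>k. codable (sdrop k \<omega>) \<and> coding (sdrop k \<omega>) \<in> U"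
          then have \<omega>: "codable \<omega>" "coding \<omega> \<in> U" by (metis sdrop.simps(1))+
          then have c: "coding (i ## \<omega>) = w i (coding \<omega>)" using U(1) by (intro coding_SCons) auto
          show "H V d (Suc n) (i ## \<omega>) \<le> ?c * H V' (d / \<gamma> i) n \<omega>"
          proof (cases "coding (i ## \<omega>) \<in> V \<and> resolved \<rho> (Suc n) d (i ## \<omega>)")
            case True
            then have "w i (coding \<omega>) \<in> V" using c by simp
            then have "coding \<omega> \<in> V'"
              using \<omega>(2) subsetD[OF closure_subset[of "{x \<in> U. w i x \<in> V}"]] by (simp add: V'_def)
            moreover have "resolved \<rho> n (d / \<gamma> i) \<omega>" using True by (simp add: resolved_SCons)
            ultimately have "H V' (d / \<gamma> i) n \<omega> = ennreal (gain_product J L \<alpha> n \<omega>)"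
              by (simp add: H_def)
            moreover have "ennreal (gain J L \<alpha> (i ## \<omega>)) \<le> ?c"
            proof (cases "good J L (i ## \<omega>)")
              case True
              then have "i \<in> A" using \<open>w i (coding \<omega>) \<in> V\<close> by (auto simp: A_def good_def)
              then show ?thesis using True by (simp add: gain_def)
            qed (simp add: gain_def)
            moreover have "H V d (Suc n) (i ## \<omega>) = ennreal (gain J L \<alpha> (i ## \<omega>)) * ennreal (gain_product J L \<alpha> n \<omega>)"
              using True gain_pos[OF \<alpha>, of J L "i ## \<omega>"]
              by (simp add: H_def gain_product_SCons ennreal_mult')
            ultimately show ?thesis by (simp add: mult_right_mono)
          qed (simp add: H_def)
        qed
      qed
      also have "\<dots> = ?c * (\<integral>\<^sup>+\<omega>. H V' (d / \<gamma> i) n \<omega> \<partial>P)"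
        using H_meas[OF V'] by (rule nn_integral_cmult)
      also have "\<dots> \<le> ?c * 1"
        using Suc.IH[OF V' d'] by (intro mult_left_mono) (auto simp: H_def)
      finally show ?thesis by simp
    qed
    have "(\<integral>\<^sup>+\<omega>. H V d (Suc n) \<omega> \<partial>P) = (\<integral>\<^sup>+i. (\<integral>\<^sup>+\<omega>. H V d (Suc n) (i ## \<omega>) \<partial>P) \<partial>measure_pmf p)"
      using H_meas[OF Suc.prems(1)] by (rule prob_space.nn_integral_stream_space[OF prob_space_measure_pmf])
    also have "\<dots> \<le> (\<integral>\<^sup>+i. ennreal (1 - \<alpha>) + ennreal (\<alpha> / pmf p i) * indicator A i \<partial>measure_pmf p)"
      by (intro nn_integral_mono inner)
    also have "\<dots> = ennreal (1 - \<alpha>) + (\<integral>\<^sup>+i. ennreal (\<alpha> / pmf p i) * indicator A i \<partial>measure_pmf p)"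
      by (subst nn_integral_add) (auto simp: measure_pmf.emeasure_space_1[simplified])
    also have "(\<integral>\<^sup>+i. ennreal (\<alpha> / pmf p i) * indicator A i \<partial>measure_pmf p) \<le> ennreal \<alpha>"
    proof (cases "A = {}")
      case False
      \<comment> \<open>The probability of \<open>i0\<close> cancels the denominator in
        \<open>\<alpha> / pmf p i0\<close>.\<close>
      then obtain i0 where "A = {i0}" using A_unique by blast
      then show ?thesis using p_pos[of i0] \<alpha>
        by (simp add: nn_integral_indicator_singleton emeasure_pmf_single ennreal_mult'[symmetric])
    qed simp
    finally show ?thesis using \<alpha> by (simp add: H_def flip: ennreal_plus)
  qed
qed

text \<open>The images of \<open>L\<close> are compact and pairwise disjoint, hence at positive
  distance, and \<open>J\<close> has only finitely many pairs.\<close>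

lemma exists_separation:
  assumes J: "finite J" and L: "compact L" "L \<subseteq> U"
  shows "\<exists>\<rho>>0. \<forall>i\<in>J. \<forall>j\<in>J. i \<noteq> j \<longrightarrow> (\<forall>x\<in>L. \<forall>y\<in>L. \<rho> \<le> dist (w i x) (w j y))"
proof -
  have compact: "compact (w i ` L)" for i
  proof (rule compact_continuous_image[OF _ L(1)])
    have "(\<Gamma> i)-lipschitz_on L (w i)"
      using L U(1) \<Gamma>_pos[of i] by (intro lipschitz_onI lipschitz) auto
    then show "continuous_on L (w i)" by (rule lipschitz_on_continuous_on)
  qed
  have "\<exists>d>0. \<forall>x\<in>L. \<forall>y\<in>L. d \<le> dist (w i x) (w j y)" if "i \<noteq> j" for i j
  proof -
    have "w i ` L \<inter> w j ` L = {}" using disjoint[OF that] L(2) by blast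
    from separate_compact_closed[OF compact compact_imp_closed[OF compact] this] show ?thesis by auto
  qed
  then obtain \<delta> where \<delta>: "\<And>i j. i \<noteq> j \<Longrightarrow> \<delta> i j > 0"
    "\<And>i j x y. i \<noteq> j \<Longrightarrow> x \<in> L \<Longrightarrow> y \<in> L \<Longrightarrow> \<delta> i j \<le> dist (w i x) (w j y)"
    by metis
  \<comment> \<open>The element 1 keeps \<open>S\<close> nonempty when \<open>J\<close> has fewer
    than two letters.\<close>
  define S where "S = insert 1 ((\<lambda>(i, j). \<delta> i j) ` {(i, j) \<in> J \<times> J. i \<noteq> j})"
  have "finite {(i, j) \<in> J \<times> J. i \<noteq> j}" by (rule finite_subset[of _ "J \<times> J"]) (use J in auto)
  then have S: "finite S" "S \<noteq> {}" by (auto simp: S_def)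
  have "Min S > 0" using S by (subst Min_gr_iff) (auto simp: S_def \<delta>)
  moreover have "Min S \<le> dist (w i x) (w j y)" if "i \<in> J" "j \<in> J" "i \<noteq> j" "x \<in> L" "y \<in> L" for i j x y
  proof -
    have "Min S \<le> \<delta> i j" using S that by (intro Min_le) (auto simp: S_def)
    then show ?thesis using \<delta>(2)[OF that(3-5)] by linarith
  qed
  ultimately show ?thesis by blast
qed

text \<open>Inner regularity of \<open>\<mu>\<close> on \<open>U\<close>, which has full measure;
  finite unions make the sequence increasing.\<close>

lemma exists_compact_exhaustion:
  obtains L :: "nat \<Rightarrow> 'a set" where "\<And>m. compact (L m)" "\<And>m. L m \<subseteq> U" "incseq L"
    "AE \<omega> in P. coding \<omega> \<in> (\<Union>m. L m)"
proof -
  interpret \<mu>: prob_space \<mu> by (rule prob_space_\<mu>)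
  have "AE \<omega> in P. coding \<omega> \<in> U"
    using AE_coding_in_U by eventually_elim (metis sdrop.simps(1))
  then have U1: "emeasure \<mu> U = 1"
    using P.emeasure_eq_1_AE[of "coding -` U"] measurable_sets[OF measurable_coding U(2)] U(2)
    by (simp add: emeasure_\<mu>)
  have "\<exists>K. K \<subseteq> U \<and> compact K \<and> ennreal (1 - inverse (Suc m)) < emeasure \<mu> K" for m
  proof -
    have "emeasure \<mu> U = (SUP K \<in> {K. K \<subseteq> U \<and> compact K}. emeasure \<mu> K)"
      by (rule inner_regular) (auto simp: U)
    moreover have "ennreal (1 - inverse (Suc m)) < emeasure \<mu> U"
      unfolding U1 by (subst ennreal_1[symmetric], subst ennreal_less_iff) (auto simp: inverse_le_1_iff)
    ultimately show ?thesis by (auto simp: less_SUP_iff)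
  qed
  then obtain K where K: "\<And>m. K m \<subseteq> U" "\<And>m. compact (K m)"
    "\<And>m. ennreal (1 - inverse (Suc m)) < emeasure \<mu> (K m)" by metis
  define L where "L m = (\<Union>k\<le>m. K k)" for m
  have "emeasure \<mu> (\<Union>m. L m) = 1"
  proof (rule antisym)
    show "emeasure \<mu> (\<Union>m. L m) \<le> 1" by (rule \<mu>.emeasure_le_1)
    have "(\<lambda>m. ennreal (1 - inverse (Suc m))) \<longlonglongrightarrow> ennreal (1 - 0)"
      by (intro tendsto_ennrealI tendsto_diff tendsto_const LIMSEQ_inverse_real_of_nat)
    moreover have "ennreal (1 - inverse (Suc m)) \<le> emeasure \<mu> (\<Union>m. L m)" for m
    proof -
      have "emeasure \<mu> (K m) \<le> emeasure \<mu> (\<Union>m. L m)"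
        using K(2) by (intro emeasure_mono) (auto simp: L_def intro!: borel_compact sets.countable_UN)
      then show ?thesis using K(3)[of m] by order
    qed
    ultimately show "1 \<le> emeasure \<mu> (\<Union>m. L m)"
      using LIMSEQ_le_const2[of _ "ennreal (1 - 0)"] by force
  qed
  moreover have L_sets: "(\<Union>m. L m) \<in> sets borel"
    using K(2) by (auto simp: L_def intro!: borel_compact sets.countable_UN)
  ultimately have "emeasure P (coding -` (\<Union>m. L m)) = 1" by (simp add: emeasure_\<mu>)
  then have "AE \<omega> in P. coding \<omega> \<in> (\<Union>m. L m)"
    using P.AE_prob_1[of "coding -` (\<Union>m. L m)"] by (simp add: P.emeasure_eq_measure)
  moreover have "incseq L" by (auto simp: L_def incseq_def intro: order_trans)
  moreover have "compact (L m)" "L m \<subseteq> U" for m using K by (auto simp: L_def)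
  ultimately show ?thesis using that by blast
qed

text \<open>As the letter sets and compact sets grow, almost every first step becomes good and the
  logarithmic gain tends to \<open>ln \<alpha> - ln (pmf p (shd \<omega>))\<close>. By dominated
  convergence its mean tends to the entropy plus \<open>ln \<alpha>\<close>.\<close>

lemma exists_gain_rate:
  assumes h: "h < - (\<integral>i. ln (pmf p i) \<partial>measure_pmf p)"
  obtains J L \<alpha> where "finite J" "compact L" "L \<subseteq> U" "0 < \<alpha>" "\<alpha> < 1"
    "integrable P (\<lambda>\<omega>. ln (gain J L \<alpha> \<omega>))" "h < (\<integral>\<omega>. ln (gain J L \<alpha> \<omega>) \<partial>P)"
proof -
  obtain L :: "nat \<Rightarrow> 'a set" where L: "\<And>m. compact (L m)" "\<And>m. L m \<subseteq> U" "incseq L"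
    "AE \<omega> in P. coding \<omega> \<in> (\<Union>m. L m)" using exists_compact_exhaustion by blast
  define h0 where "h0 = - (\<integral>i. ln (pmf p i) \<partial>measure_pmf p)"
  \<comment> \<open>Then \<open>h0 + ln \<alpha>\<close> is the midpoint of \<open>h\<close> and
    \<open>h0\<close>, still above \<open>h\<close>.\<close>
  define \<alpha> where "\<alpha> = exp ((h - h0) / 2)"
  have \<alpha>: "0 < \<alpha>" "\<alpha> < 1" "h < h0 + ln \<alpha>" using h by (auto simp: \<alpha>_def h0_def)
  define J :: "nat \<Rightarrow> 'i set" where "J m = {i. to_nat i \<le> m}" for m
  have J: "finite (J m)" for m
    unfolding J_def by (rule finite_subset[of _ "from_nat ` {..m}"]) (auto intro!: image_eqI[of _ from_nat "to_nat _"])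
  let ?g = "\<lambda>m \<omega>. ln (gain (J m) (L m) \<alpha> \<omega>)"
  let ?dom = "\<lambda>\<omega>. \<bar>ln \<alpha>\<bar> + \<bar>ln (1 - \<alpha>)\<bar> + \<bar>ln (pmf p (shd \<omega>))\<bar>"
  have int_lnp: "integrable P (\<lambda>\<omega>. ln (pmf p (shd \<omega>)))" by (rule integrable_shd[OF ln_p])
  then have int_dom: "integrable P ?dom" by simp
  have meas: "?g m \<in> borel_measurable P" for m
    using measurable_gain[of "L m" "J m" \<alpha>] L(1)[of m] by (simp add: borel_compact)
  have dom: "norm (?g m \<omega>) \<le> ?dom \<omega>" for m \<omega>
  proof (cases "good (J m) (L m) \<omega>")
    case True
    then have "?g m \<omega> = ln \<alpha> - ln (pmf p (shd \<omega>))"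
      using \<alpha> p_pos[of "shd \<omega>"] by (simp add: gain_def ln_div)
    then show ?thesis unfolding real_norm_def by linarith
  next
    case False
    then have "?g m \<omega> = ln (1 - \<alpha>)" by (simp add: gain_def)
    then show ?thesis unfolding real_norm_def by linarith
  qed
  have int: "integrable P (?g m)" for m
    by (rule Bochner_Integration.integrable_bound[OF int_dom meas]) (use dom in \<open>auto intro!: AE_I2\<close>)
  have "(\<lambda>m. \<integral>\<omega>. ?g m \<omega> \<partial>P) \<longlonglongrightarrow> (\<integral>\<omega>. ln \<alpha> - ln (pmf p (shd \<omega>)) \<partial>P)"
  proof (rule integral_dominated_convergence[where w = ?dom])
    have "AE \<omega> in P. \<forall>k. coding (sdrop k \<omega>) \<in> (\<Union>m. L m)" using L(4) by (rule AE_sdrop)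
    then show "AE \<omega> in P. (\<lambda>m. ?g m \<omega>) \<longlonglongrightarrow> ln \<alpha> - ln (pmf p (shd \<omega>))"
    proof eventually_elim
      fix \<omega> assume "\<forall>k. coding (sdrop k \<omega>) \<in> (\<Union>m. L m)"
      from this[rule_format, of 1] obtain N where N: "coding (stl \<omega>) \<in> L N" by auto
      have "?g m \<omega> = ln \<alpha> - ln (pmf p (shd \<omega>))" if "m \<ge> max N (to_nat (shd \<omega>))" for m
      proof -
        have "good (J m) (L m) \<omega>"
          using that N incseqD[OF L(3), of N m] by (auto simp: good_def J_def)
        then show ?thesis using \<alpha> p_pos[of "shd \<omega>"] by (simp add: gain_def ln_div)
      qed
      then have "\<forall>\<^sub>F m in sequentially. ?g m \<omega> = ln \<alpha> - ln (pmf p (shd \<omega>))"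
        unfolding eventually_sequentially by blast
      then show "(\<lambda>m. ?g m \<omega>) \<longlonglongrightarrow> ln \<alpha> - ln (pmf p (shd \<omega>))" by (rule tendsto_eventually)
    qed
  qed (use int_dom int_lnp meas dom in auto)
  also have "(\<integral>\<omega>. ln \<alpha> - ln (pmf p (shd \<omega>)) \<partial>P) = ln \<alpha> + h0"
    using int_lnp integral_shd[OF ln_p] by (simp add: h0_def P.prob_space[simplified])
  finally have "\<forall>\<^sub>F m in sequentially. h < (\<integral>\<omega>. ?g m \<omega> \<partial>P)"
    using \<alpha>(3) by (intro order_tendstoD(1)) (auto simp: add.commute)
  then obtain m where "h < (\<integral>\<omega>. ?g m \<omega> \<partial>P)" by (auto dest!: eventually_happens)
  from that[OF J L(1) L(2) \<alpha>(1,2) int this] show ?thesis .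
qed

text \<open>Almost every code lies in one of countably many sets \<open>G N\<close> on which both
  growth rates hold with uniform constants. There, codes of a small set of diameter \<open>d\<close>
  have mass at most \<open>c * d powr s\<close>, so a cover with small \<open>s\<close>-sum carries
  little mass.\<close>

lemma AE_coding_notin_if_hausdorff_measure_0:
  assumes s: "0 < s" and s_less: "s * - (\<integral>i. ln (\<gamma> i) \<partial>measure_pmf p) < - (\<integral>i. ln (pmf p i) \<partial>measure_pmf p)"
    and \<gamma>_neg: "(\<integral>i. ln (\<gamma> i) \<partial>measure_pmf p) < 0"
    and E: "E \<in> sets borel" "hausdorff_measure s E = 0"
  shows "AE \<omega> in P. coding \<omega> \<notin> E"
proof -
  define h0 where "h0 = - (\<integral>i. ln (pmf p i) \<partial>measure_pmf p)"
  define l0 where "l0 = - (\<integral>i. ln (\<gamma> i) \<partial>measure_pmf p)"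
  have gap: "s * l0 < h0" and l0: "l0 > 0" using s_less \<gamma>_neg by (auto simp: h0_def l0_def)
  \<comment> \<open>The midpoint leaves room on both sides: \<open>h < h0\<close> for the gain and
    \<open>l0 < l\<close> for the expansion, while \<open>s * l = h\<close> matches the two
    exponents.\<close>
  define h where "h = (s * l0 + h0) / 2"
  define l where "l = h / s"
  have h: "h < h0" and l: "l0 < l" "0 < l" and sl: "s * l = h"
  proof -
    show "h < h0" "l0 < l" "s * l = h" using gap s by (auto simp: h_def l_def field_simps)
    then show "0 < l" using l0 by simp
  qed
  then have h_pos: "h > 0" using s by (metis mult_pos_pos)
  obtain J L \<alpha> where J: "finite J" and L: "compact L" "L \<subseteq> U" and \<alpha>: "0 < \<alpha>" "\<alpha> < 1"
    and int: "integrable P (\<lambda>\<omega>. ln (gain J L \<alpha> \<omega>))" "h < (\<integral>\<omega>. ln (gain J L \<alpha> \<omega>) \<partial>P)"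
    using exists_gain_rate[of h] h unfolding h0_def by blast
  have L_sets [measurable]: "L \<in> sets borel" using L(1) by (rule borel_compact)
  obtain \<rho> where \<rho>: "\<rho> > 0" and
    "\<forall>i\<in>J. \<forall>j\<in>J. i \<noteq> j \<longrightarrow> (\<forall>x\<in>L. \<forall>y\<in>L. \<rho> \<le> dist (w i x) (w j y))"
    using exists_separation[OF J L] by blast
  then have sep: "\<And>i j x y. i \<in> J \<Longrightarrow> j \<in> J \<Longrightarrow> i \<noteq> j \<Longrightarrow> x \<in> L \<Longrightarrow> y \<in> L \<Longrightarrow> \<rho> \<le> dist (w i x) (w j y)"
    by blast
  define G where "G N = {\<omega>. \<forall>n::nat. exp (n * h - real N) \<le> gain_product J L \<alpha> n \<omega> \<and>
      exp (- real N - n * l) \<le> (\<Prod>k<n. \<gamma> (\<omega> !! k))}" for N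
  have G_sets [measurable]: "G N \<in> sets P" for N
  proof -
    have "{\<omega> \<in> space P. \<forall>n::nat. exp (n * h - real N) \<le> gain_product J L \<alpha> n \<omega> \<and>
      exp (- real N - n * l) \<le> (\<Prod>k<n. \<gamma> (\<omega> !! k))} \<in> sets P" by measurable
    then show ?thesis by (simp add: G_def)
  qed
  have null: "emeasure P (G N \<inter> coding -` E) = 0" for N
  proof -
    \<comment> \<open>On \<open>G N\<close>, any \<open>d < d0 * exp (- real n * l)\<close> is
      resolved for \<open>n\<close> letters.\<close>
    define d0 where "d0 = \<rho> * exp (- real N)"
    have d0: "d0 > 0" using \<rho> by (simp add: d0_def)
    define c where "c = exp (real N + h) * d0 powr (- s)"
    \<comment> \<open>Markov's inequality for the gain product, which is at least
      \<open>exp (n * h - real N)\<close> on \<open>G N\<close>.\<close>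
    have small: "emeasure P (G N \<inter> coding -` V) \<le> ennreal (exp (real N - n * h))"
      if V: "closed V" "\<And>x y. x \<in> V \<Longrightarrow> y \<in> V \<Longrightarrow> dist x y \<le> d" and n: "d < d0 * exp (- real n * l)" for V d n
    proof -
      have [measurable]: "V \<in> sets borel" using V(1) by simp
      have res: "resolved \<rho> n d \<omega>" if "\<omega> \<in> G N" for \<omega>
        unfolding resolved_def
      proof (intro allI impI)
        fix k assume "k < n"
        then have "d0 * exp (- real n * l) \<le> \<rho> * exp (- real N - real k * l)"
          using \<rho> l by (simp add: d0_def mult.assoc exp_add[symmetric])
        also have "\<dots> \<le> \<rho> * (\<Prod>j<k. \<gamma> (\<omega> !! j))"
          using \<rho> that by (intro mult_left_mono) (auto simp: G_def)
        finally show "d < \<rho> * (\<Prod>j<k. \<gamma> (\<omega> !! j))" using n by simp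
      qed
      have "ennreal (exp (n * h - real N)) * emeasure P (G N \<inter> coding -` V)
          = (\<integral>\<^sup>+\<omega>. ennreal (exp (n * h - real N)) * indicator (G N \<inter> coding -` V) \<omega> \<partial>P)"
        using measurable_sets[OF measurable_coding, of V] by (subst nn_integral_cmult_indicator) auto
      also have "\<dots> \<le> (\<integral>\<^sup>+\<omega>. indicator {\<omega>. coding \<omega> \<in> V \<and> resolved \<rho> n d \<omega>} \<omega> * ennreal (gain_product J L \<alpha> n \<omega>) \<partial>P)"
      proof (intro nn_integral_mono)
        fix \<omega>
        have "exp (n * h - real N) \<le> gain_product J L \<alpha> n \<omega>" if "\<omega> \<in> G N" using that by (simp add: G_def)
        then show "ennreal (exp (n * h - real N)) * indicator (G N \<inter> coding -` V) \<omega>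
            \<le> indicator {\<omega>. coding \<omega> \<in> V \<and> resolved \<rho> n d \<omega>} \<omega> * ennreal (gain_product J L \<alpha> n \<omega>)"
          using res[of \<omega>] by (cases "\<omega> \<in> G N \<inter> coding -` V") (auto intro: ennreal_leI)
      qed
      also have "\<dots> \<le> 1" by (rule gain_product_integral_le_1[OF L(2) L_sets \<alpha> sep V])
      finally have "ennreal (exp (real N - n * h)) * (ennreal (exp (n * h - real N)) * emeasure P (G N \<inter> coding -` V))
         \<le> ennreal (exp (real N - n * h)) * 1" by (rule mult_left_mono) simp
      then show ?thesis by (simp add: mult.assoc[symmetric] ennreal_mult'[symmetric] exp_add[symmetric])
    qed
    have mass: "emeasure P (G N \<inter> coding -` V) \<le> ennreal (c * d powr s)"
      if V: "closed V" "\<And>x y. x \<in> V \<Longrightarrow> y \<in> V \<Longrightarrow> dist x y \<le> d" and d: "0 \<le> d" "d < d0" for V d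
    proof (cases "d = 0")
      case True
      \<comment> \<open>Diameter 0 is resolved for every \<open>n\<close>, so letting
        \<open>n\<close> grow gives mass 0, in accordance with \<open>0 powr s = 0\<close>.\<close>
      have "(\<lambda>n. ennreal (exp (real N) * exp (- h) ^ n)) \<longlonglongrightarrow> ennreal (exp (real N) * 0)"
        using h_pos by (intro tendsto_ennrealI tendsto_mult tendsto_const LIMSEQ_realpow_zero) auto
      moreover have "emeasure P (G N \<inter> coding -` V) \<le> ennreal (exp (real N) * exp (- h) ^ n)" for n
        using small[OF V, of n] True d0 by (simp add: exp_diff exp_minus exp_of_nat_mult[symmetric] power_inverse field_simps)
      ultimately have "emeasure P (G N \<inter> coding -` V) \<le> ennreal (exp (real N) * 0)"
        by (intro LIMSEQ_le_const) auto
      then show ?thesis by simp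
    next
      case False
      then have d_pos: "d > 0" using d by simp
      define y where "y = ln (d0 / d) / l"
      have y: "y > 0" using d d_pos l by (simp add: y_def)
      \<comment> \<open>The largest natural number strictly below \<open>y\<close>, since
        \<open>small\<close> asks for a strict inequality. Rounding loses at most one step, which is
        the factor \<open>exp h\<close> in \<open>c\<close>.\<close>
      define n where "n = nat (\<lceil>y\<rceil> - 1)"
      have n: "real n < y" "y \<le> real n + 1" using y unfolding n_def by linarith+
      have "d = d0 * exp (- (y * l))" using d_pos d0 l by (simp add: y_def exp_minus)
      also have "\<dots> < d0 * exp (- real n * l)" using n(1) d0 l by simp
      finally have "emeasure P (G N \<inter> coding -` V) \<le> ennreal (exp (real N - n * h))"
        using small[OF V] by blast
      also have "exp (real N - n * h) \<le> exp (real N + h - y * h)"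
        using mult_right_mono[OF n(2), of h] h_pos by (simp add: algebra_simps)
      also have "\<dots> = c * d powr s"
      proof -
        have "y * h = s * ln (d0 / d)" using l by (simp add: y_def flip: sl)
        then show ?thesis using d0 d_pos
          by (simp add: c_def powr_def ln_div exp_add[symmetric] algebra_simps)
      qed
      finally show ?thesis by (simp add: ennreal_leI)
    qed
    have c: "c > 0" using d0 by (simp add: c_def)
    have "emeasure P (G N \<inter> coding -` E) \<le> 0"
    proof (rule ennreal_le_epsilon)
      fix e :: real assume e: "e > 0"
      \<comment> \<open>Covering at scale \<open>d0 / 2\<close> keeps every diameter strictly below
        \<open>d0\<close>, as \<open>mass\<close> requires.\<close>
      have "hausdorff_content s (d0 / 2) E \<le> hausdorff_measure s E"
        unfolding hausdorff_measure_def using d0 by (intro SUP_upper) auto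
      then have "hausdorff_content s (d0 / 2) E < ennreal (e / c)" using E(2) e c by simp
      then obtain V where V: "E \<subseteq> (\<Union>j::nat. V j)" "\<And>j. bounded (V j) \<and> diameter (V j) \<le> d0 / 2"
        and sum: "(\<Sum>j. ennreal (diameter (V j) powr s)) < ennreal (e / c)"
        unfolding hausdorff_content_def INF_less_iff by auto
      \<comment> \<open>Sets of a cover may be non-measurable; closures are measurable and have the
        same diameter.\<close>
      let ?B = "\<lambda>j. G N \<inter> coding -` closure (V j)"
      have B: "?B j \<in> sets P" for j
        using measurable_sets[OF measurable_coding, of "closure (V j)"] by auto
      have "emeasure P (G N \<inter> coding -` E) \<le> emeasure P (\<Union>j. ?B j)"
      proof (rule emeasure_mono)
        have "E \<subseteq> (\<Union>j. closure (V j))" using V(1) by (rule order_trans) (intro UN_mono closure_subset order_refl)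
        then show "G N \<inter> coding -` E \<subseteq> (\<Union>j. ?B j)" by blast
        show "(\<Union>j. ?B j) \<in> sets P" using B by (intro sets.countable_UN) blast
      qed
      also have "\<dots> \<le> (\<Sum>j. emeasure P (?B j))"
        using B by (intro emeasure_subadditive_countably) auto
      also have "\<dots> \<le> (\<Sum>j. ennreal c * ennreal (diameter (V j) powr s))"
      proof (intro suminf_le)
        fix j
        have "bounded (closure (V j))" "diameter (closure (V j)) = diameter (V j)"
          using V(2)[of j] by (auto simp: diameter_closure)
        then have "emeasure P (?B j) \<le> ennreal (c * diameter (V j) powr s)"
          using V(2)[of j] d0 diameter_bounded_bound[of "closure (V j)"] diameter_ge_0[of "V j"] by (intro mass) auto
        then show "emeasure P (?B j) \<le> ennreal c * ennreal (diameter (V j) powr s)"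
          using c by (simp add: ennreal_mult')
      qed auto
      also have "\<dots> \<le> ennreal c * ennreal (e / c)"
        using sum by (simp add: mult_left_mono)
      also have "\<dots> = ennreal e" using c e by (simp add: ennreal_mult'[symmetric])
      finally show "emeasure P (G N \<inter> coding -` E) \<le> 0 + ennreal e" by simp
    qed
    then show ?thesis by simp
  qed
  have "AE \<omega> in P. \<forall>N. \<not> (\<omega> \<in> G N \<and> coding \<omega> \<in> E)"
    unfolding AE_all_countable
  proof
    fix N
    have "G N \<inter> coding -` E \<in> null_sets P"
      using null[of N] measurable_sets[OF measurable_coding E(1)] by (auto simp: null_sets_def)
    then show "AE \<omega> in P. \<not> (\<omega> \<in> G N \<and> coding \<omega> \<in> E)"
      using AE_not_in by fastforce
  qed
  \<comment> \<open>The one-sided bounds are from above, so lower bounds on products come from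
    negated logarithms.\<close>
  moreover have "AE \<omega> in P. \<exists>C. \<forall>n. (\<Sum>k<n. - ln (gain J L \<alpha> (sdrop k \<omega>))) \<le> C + real n * (- h)"
    using int by (intro birkhoff_sum_linear_bound) auto
  moreover have "AE \<omega> in P. \<exists>C. \<forall>n. (\<Sum>k<n. - ln (\<gamma> (\<omega> !! k))) \<le> C + real n * l"
    using ln_\<gamma> l by (intro letter_sum_linear_bound) (auto simp: l0_def)
  ultimately show ?thesis
  proof eventually_elim
    fix \<omega>
    assume notin: "\<forall>N. \<not> (\<omega> \<in> G N \<and> coding \<omega> \<in> E)"
      and "\<exists>C. \<forall>n. (\<Sum>k<n. - ln (gain J L \<alpha> (sdrop k \<omega>))) \<le> C + real n * (- h)"
      and "\<exists>C. \<forall>n. (\<Sum>k<n. - ln (\<gamma> (\<omega> !! k))) \<le> C + real n * l"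
    then obtain C1 C2 where C1: "\<And>n. (\<Sum>k<n. - ln (gain J L \<alpha> (sdrop k \<omega>))) \<le> C1 + real n * (- h)"
      and C2: "\<And>n. (\<Sum>k<n. - ln (\<gamma> (\<omega> !! k))) \<le> C2 + real n * l" by blast
    obtain N :: nat where N: "C1 \<le> N" "C2 \<le> N" using real_arch_simple[of "max C1 C2"] by auto
    have "\<omega> \<in> G N"
      unfolding G_def
    proof (intro CollectI allI conjI)
      fix n
      have "exp (n * h - real N) \<le> exp (\<Sum>k<n. ln (gain J L \<alpha> (sdrop k \<omega>)))"
        using C1[of n] N by (simp add: sum_negf)
      also have "\<dots> = gain_product J L \<alpha> n \<omega>"
        by (simp add: gain_product_def exp_sum gain_pos[OF \<alpha>])
      finally show "exp (n * h - real N) \<le> gain_product J L \<alpha> n \<omega>" .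
      have "exp (- real N - n * l) \<le> exp (\<Sum>k<n. ln (\<gamma> (\<omega> !! k)))"
        using C2[of n] N by (simp add: sum_negf)
      also have "\<dots> = (\<Prod>k<n. \<gamma> (\<omega> !! k))"
        by (simp add: exp_sum \<gamma>_pos)
      finally show "exp (- real N - n * l) \<le> (\<Prod>k<n. \<gamma> (\<omega> !! k))" .
    qed
    then show "coding \<omega> \<notin> E" using notin by blast
  qed
qed

end

section \<open>The dimension bounds under the strong open set condition\<close>

theorem theorem1p1:
  fixes X :: "'a::euclidean_space set"
    and w :: "'i::countable \<Rightarrow> 'a \<Rightarrow> 'a"
    and p :: "'i pmf"
    and \<gamma> \<Gamma> :: "'i \<Rightarrow> real"
  assumes maps: "\<And>i. w i ` X \<subseteq> X"
    and p_pos: "\<And>i. pmf p i > 0"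
    and const: "\<And>i. 0 < \<gamma> i \<and> \<gamma> i < \<Gamma> i"
    and bilip: "\<And>i x y. x \<in> X \<Longrightarrow> y \<in> X \<Longrightarrow>
                  \<gamma> i * dist x y \<le> dist (w i x) (w i y) \<and> dist (w i x) (w i y) \<le> \<Gamma> i * dist x y"
    and avg_contr: "\<exists>x\<in>X. (\<lambda>i. pmf p i * \<Gamma> i) summable_on UNIV
                      \<and> (\<lambda>i. pmf p i * dist (w i x) x) summable_on UNIV
                      \<and> (\<lambda>i. pmf p i * ln (\<Gamma> i)) summable_on UNIV
                      \<and> (\<Sum>\<^sub>\<infinity>i. pmf p i * ln (\<Gamma> i)) < 0"
    and entropy: "(\<lambda>i. pmf p i * ln (pmf p i)) summable_on UNIV"
    and SOSC: "\<exists>U. openin (top_of_set X) U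
                  \<and> (\<forall>i. w i ` U \<subseteq> U)
                  \<and> (\<forall>i j. i \<noteq> j \<longrightarrow> w i ` U \<inter> w j ` U = {})
                  \<and> emeasure (ifs_measure X w p) U > 0"
    and lower_lip: "(\<lambda>i. pmf p i * ln (\<gamma> i)) summable_on UNIV"
  shows "let \<mu> = ifs_measure X w p;
             s_lo = (\<Sum>\<^sub>\<infinity>i. pmf p i * ln (pmf p i)) / (\<Sum>\<^sub>\<infinity>i. pmf p i * ln (\<gamma> i));
             s_up = (\<Sum>\<^sub>\<infinity>i. pmf p i * ln (pmf p i)) / (\<Sum>\<^sub>\<infinity>i. pmf p i * ln (\<Gamma> i))
         in (s_lo \<le> hausdorff_dim_measure \<mu> \<and> hausdorff_dim_measure \<mu> \<le> upper_hausdorff_dim_measure \<mu>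
               \<and> upper_hausdorff_dim_measure \<mu> \<le> s_up)
          \<and> (s_lo \<le> packing_dim_measure \<mu> \<and> packing_dim_measure \<mu> \<le> upper_packing_dim_measure \<mu>
               \<and> upper_packing_dim_measure \<mu> \<le> s_up)"
proof -
  obtain a where a: "a \<in> X" and drift: "(\<lambda>i. pmf p i * dist (w i a) a) summable_on UNIV"
    and ln_\<Gamma>: "(\<lambda>i. pmf p i * ln (\<Gamma> i)) summable_on UNIV" "(\<Sum>\<^sub>\<infinity>i. pmf p i * ln (\<Gamma> i)) < 0"
    using avg_contr by blast
  obtain U where U: "openin (top_of_set X) U" "\<And>i. w i ` U \<subseteq> U"
    "\<And>i j. i \<noteq> j \<Longrightarrow> w i ` U \<inter> w j ` U = {}" "emeasure (ifs_measure X w p) U > 0"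
    using SOSC by blast
  \<comment> \<open>\<open>U\<close> is only relatively open in an arbitrary \<open>X\<close>. Sets
    outside the sigma-algebra have \<open>emeasure\<close> 0, so positive mass forces
    measurability.\<close>
  have U_sets: "U \<in> sets borel"
  proof (rule ccontr)
    assume "U \<notin> sets borel"
    then have "U \<notin> sets (ifs_measure X w p)" by (simp add: ifs_measure_def)
    then show False using U(4) by (simp add: emeasure_notin_sets)
  qed
  have \<gamma>_pos: "\<gamma> i > 0" and \<Gamma>_pos: "\<Gamma> i > 0" and ln_less: "ln (\<gamma> i) < ln (\<Gamma> i)" for i
    using const[of i] by auto
  note int_p = integrable_measure_pmf_if_summable[OF entropy]
    and int_\<Gamma> = integrable_measure_pmf_if_summable[OF ln_\<Gamma>(1)]
    and int_\<gamma> = integrable_measure_pmf_if_summable[OF lower_lip]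
  interpret separated_ifs p X w \<Gamma> a U \<gamma>
  proof unfold_locales
    show "integrable (measure_pmf p) (\<lambda>i. dist (w i a) a)"
      by (rule integrable_measure_pmf_if_summable[OF drift])
    show "w i x \<in> U" if "x \<in> U" for i x using U(2) that by blast
    show "w i x \<in> X" if "x \<in> X" for i x using maps that by blast
    show "w i ` U \<inter> w j ` U = {}" if "i \<noteq> j" for i j using U(3) that .
    show "U \<subseteq> X" using openin_imp_subset[OF U(1)] .
  qed (use \<Gamma>_pos \<gamma>_pos bilip a int_\<Gamma> ln_\<Gamma>(2) int_p int_\<gamma> p_pos U(4) U_sets in auto)
  let ?h = "\<integral>i. ln (pmf p i) \<partial>measure_pmf p"
    and ?up = "\<integral>i. ln (\<Gamma> i) \<partial>measure_pmf p" and ?lo = "\<integral>i. ln (\<gamma> i) \<partial>measure_pmf p"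
  \<comment> \<open>Makes the denominator of the lower quotient negative, like that of the upper
    one.\<close>
  have "?lo \<le> ?up"
    using int_\<gamma>(1) int_\<Gamma>(1) by (rule integral_mono) (rule less_imp_le[OF ln_less])
  then have lo_neg: "?lo < 0" using ln_\<Gamma>(2) int_\<Gamma>(2) by simp
  have lower: "?h / ?lo \<le> hausdorff_dim E" if E: "E \<in> sets (ifs_measure X w p)" "emeasure (ifs_measure X w p) E > 0" for E
  proof (rule le_hausdorff_dim, rule ccontr)
    fix s assume s: "0 < s" "hausdorff_measure s E = 0" and "\<not> ?h / ?lo \<le> s"
    then have "s * - ?lo < - ?h" using lo_neg by (simp add: not_le less_divide_eq mult.commute)
    moreover have E_borel: "E \<in> sets borel" using E(1) by simp
    ultimately have "AE \<omega> in P. \<omega> \<notin> coding -` E"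
      using AE_coding_notin_if_hausdorff_measure_0[of s E] s lo_neg by simp
    then have "emeasure P (coding -` E) = 0"
      using AE_iff_measurable[of "coding -` E" P "\<lambda>\<omega>. \<omega> \<notin> coding -` E"]
        measurable_sets[OF measurable_coding E_borel] by (simp add: vimage_def)
    then show False using E(2) by (simp add: emeasure_\<mu>[OF E_borel])
  qed
  have upper: "\<exists>E\<in>sets (ifs_measure X w p). emeasure (ifs_measure X w p) E = 1 \<and> packing_dim E \<le> t"
    if "t > ?h / ?up" for t
    using exists_full_measure_packing_dim_le[OF p_pos int_p(1) that] .
  note bounds = dim_measure_bounds[OF prob_space_\<mu> lower upper, unfolded int_p(2) int_\<Gamma>(2) int_\<gamma>(2)]
  from bounds show ?thesis unfolding Let_def by (intro conjI)
qed

end
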